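(* For all integers $1 \le k < n$, the maps \[ \mathrm{Rev}_{n,k}:\mathcal{B}(n,k)\to\mathcal{C}(n,k+1),\qquad \mathrm{Corev}_{n,n-k}:\mathcal{B}^*(n,n-k)\to\mathcal{C}^*(n,n-k-1), \] \[ \beta_{n,k}:\mathcal{B}(n,k)\to\mathcal{B}^*(n,n-k),\qquad \gamma_{n,k+1}:\mathcal{C}(n,k+1)\to\mathcal{C}^*(n,n-k-1) \] (defined in the context) are poset isomorphisms, and the square they form commutes, i.e. $\gamma_{n,k+1}\circ \mathrm{Rev}_{n,k}=\mathrm{Corev}_{n,n-k}\circ\beta_{n,k}$.
   Context: Let $[n]=\{1,\dots,n\}$ and let $\binom{[n]}{k}$ be the set of $k$-element subsets of $[n]$, each written in increasing order; $\binom{[n]}{0}=\{\varnothing\}$, and $\binom{[n]}{k}=\varnothing$ if $k>n$ or $k<0$. For $X=[x_1<\dots<x_k]$ let $X_i=X\setminus\{x_i\}$. The packet of $X$ is $P(X)=\{X_1,\dots,X_k\}$; the copacket of $X\subseteq[n]$ is $P^*(X)=\{X\cup\{i\}: i\in[n]\setminus X\}$. The lex order on $\binom{[n]}{k}$ is the lexicographic order of increasing sequences and antilex is its reverse; subsets of $\binom{[n]}{k}$ (such as packets and copackets) inherit lex and antilex orders. A prefix (suffix) of a finite totally ordered set is a possibly empty initial (final) segment. Total orders on $\binom{[n]}{k}$ are written as sequences $\rho=(\rho_1,\dots,\rho_{\binom nk})$. $X,Y\in\binom{[n]}{k}$ commute if $P(X)\cap P(Y)=\varnothing$. Two total orders on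 $\binom{[n]}{k}$ are commutation equivalent if one is obtained from the other by a sequence of transpositions of adjacent commuting elements; $[\rho]$ denotes the commutation class of $\rho$. A total order $\rho$ on $\binom{[n]}{k}$ is admissible if for every $X\in\binom{[n]}{k+1}$ the restriction $\rho|_{P(X)}$ is the lex or the antilex order on $P(X)$; it is coadmissible if for every $X\in\binom{[n]}{k-1}$ the restriction $\rho|_{P^*(X)}$ is the lex or the antilex order on $P^*(X)$. (Both properties are preserved by commutation.) $\mathcal{B}(n,k)$ is the set of commutation classes of admissible orders on $\binom{[n]}{k}$, partially ordered by the reflexive-transitive closure of the relations $[\rho]\lessdot[\sigma]$ holding when there are $\rho'\in[\rho]$, $\sigma'\in[\sigma]$ and $X\in\binom{[n]}{k+1}$ such that the elements of $P(X)$ occur consecutively in $\rho'$ in lex order and $\sigma'$ is obtained from $\rho'$ by reversing this block. $\mathcal{B}^*(n,k)$ is the set of commutation classes of coadmissible orders on $\binom{[n]}{k}$, ordered in the same way with $P(X)$, $X\in\binom{[n]}{k+1}$ replaced by $P^*(X)$, $X\in\binom{[n]}{k-1}$. A subset $I\subseteq\binom{[n]}{k}$ is consistent if for every $X\in\binom{[n]}{k+1}$ the set $P(X)\cap I$ is a prefix or suffix of $P(X)$ in lex order; it is coconsistent if for every $X\in\binom{[n]}{k-1}$ the set $P^*(X)\cap I$ is a prefix or suffix of $P^*(X)$ in lex order (for $k=0$ this condition is vacuous). $\mathcal{C}(n,k)$ (resp. $\mathcal{C}^*(n,k)$) is the set of consistent (resp. coconsistent) subsets of $\binom{[n]}{k}$,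 partially ordered by single step inclusion: the reflexive-transitive closure of the relations $I\lessdot J$ holding when $J=I\cup\{y\}$ for some $y\notin I$ (with $I$ and $J$ both in the collection). The maps are $\mathrm{Rev}_{n,k}([\rho])=\{X\in\binom{[n]}{k+1}:\rho|_{P(X)}\text{ is the antilex order}\}$; $\mathrm{Corev}_{n,k}([\rho])=\{X\in\binom{[n]}{k-1}:\rho|_{P^*(X)}\text{ is the antilex order}\}$; $\beta_{n,k}([(\rho_1,\dots,\rho_{\binom nk})])=[([n]\setminus\rho_{\binom nk},\dots,[n]\setminus\rho_1)]$; $\gamma_{n,k}(I)=\{[n]\setminus X: X\in I\}$. *)

theory Defs
  imports Main "HOL-Library.Ramsey" "HOL-Combinatorics.Multiset_Permutations"
begin

text \<open>
  The ground set $[n]$ is \<open>{1..n}\<close>, and the set of its $k$-element subsets is \<open>[{1..n}]\<^bsup>k\<^esup>\<close>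
  (constant \<open>nsets\<close> of \<^theory>\<open>HOL-Library.Ramsey\<close>).
\<close>

definition packet :: "nat set \<Rightarrow> nat set set" where
  "packet X = (\<lambda>x. X - {x}) ` X"

definition copacket :: "nat \<Rightarrow> nat set \<Rightarrow> nat set set" where
  "copacket n X = (\<lambda>i. insert i X) ` ({1..n} - X)"

text \<open>
  The $(k-1)$-element subsets of $[n]$. Truncated subtraction would give the wrong value
  for $k = 0$, where there are none.
\<close>

definition nsets_pred :: "nat \<Rightarrow> nat \<Rightarrow> nat set set" where
  "nsets_pred n k = {X. X \<subseteq> {1..n} \<and> Suc (card X) = k}"

definition lex_less :: "nat set \<Rightarrow> nat set \<Rightarrow> bool" where
  "lex_less X Y \<longleftrightarrow> (sorted_list_of_set X, sorted_list_of_set Y) \<in> lexord less_than"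


subsection \<open>Total orders and commutation classes\<close>

text \<open>
  A total order on a finite set is the duplicate-free list of its elements, so
  its restriction to a subset is obtained by \<open>filter\<close>.
\<close>

definition restrict_order :: "nat set list \<Rightarrow> nat set set \<Rightarrow> nat set list" where
  "restrict_order \<rho> Q = filter (\<lambda>Y. Y \<in> Q) \<rho>"

definition lex_sorted :: "nat set list \<Rightarrow> bool" where
  "lex_sorted \<rho> \<longleftrightarrow> sorted_wrt lex_less \<rho>"

definition antilex_sorted :: "nat set list \<Rightarrow> bool" where
  "antilex_sorted \<rho> \<longleftrightarrow> sorted_wrt (\<lambda>X Y. lex_less Y X) \<rho>"

definition total_orders :: "nat \<Rightarrow> nat \<Rightarrow> nat set list set" where
  "total_orders n k = permutations_of_set ([{1..n}]\<^bsup>k\<^esup>)"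

definition commute :: "nat set \<Rightarrow> nat set \<Rightarrow> bool" where
  "commute X Y \<longleftrightarrow> packet X \<inter> packet Y = {}"

definition comm_step :: "nat set list rel" where
  "comm_step = {(us @ [X, Y] @ vs, us @ [Y, X] @ vs) | us vs X Y. commute X Y}"

definition comm_eq :: "nat set list rel" where
  "comm_eq = comm_step\<^sup>*"

definition comm_class :: "nat set list \<Rightarrow> nat set list set" where
  "comm_class \<rho> = comm_eq `` {\<rho>}"

definition admissible :: "nat \<Rightarrow> nat \<Rightarrow> nat set list \<Rightarrow> bool" where
  "admissible n k \<rho> \<longleftrightarrow> \<rho> \<in> total_orders n k \<and>
     (\<forall>X \<in> [{1..n}]\<^bsup>Suc k\<^esup>. lex_sorted (restrict_order \<rho> (packet X)) \<or>
                              antilex_sorted (restrict_order \<rho> (packet X)))"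

definition coadmissible :: "nat \<Rightarrow> nat \<Rightarrow> nat set list \<Rightarrow> bool" where
  "coadmissible n k \<rho> \<longleftrightarrow> \<rho> \<in> total_orders n k \<and>
     (\<forall>X \<in> nsets_pred n k. lex_sorted (restrict_order \<rho> (copacket n X)) \<or>
                           antilex_sorted (restrict_order \<rho> (copacket n X)))"


subsection \<open>The posets\<close>

text \<open>The reflexive-transitive closure, on the set \<open>A\<close>, of a relation on \<open>A\<close>.\<close>

definition closure_on :: "'a set \<Rightarrow> 'a rel \<Rightarrow> 'a rel" where
  "closure_on A r = r\<^sup>* \<inter> (A \<times> A)"

definition block_reversal :: "nat set set \<Rightarrow> nat set list rel" where
  "block_reversal Q =
     {(us @ bs @ vs, us @ rev bs @ vs) | us bs vs. set bs = Q \<and> lex_sorted bs}"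

definition Bruhat :: "nat \<Rightarrow> nat \<Rightarrow> nat set list set set" where
  "Bruhat n k = {\<rho>. admissible n k \<rho>} // comm_eq"

definition Bruhat_cover :: "nat \<Rightarrow> nat \<Rightarrow> nat set list set rel" where
  "Bruhat_cover n k = {(C, D). C \<in> Bruhat n k \<and> D \<in> Bruhat n k \<and>
     (\<exists>\<rho> \<in> C. \<exists>\<sigma> \<in> D. \<exists>X \<in> [{1..n}]\<^bsup>Suc k\<^esup>. (\<rho>, \<sigma>) \<in> block_reversal (packet X))}"

definition Bruhat_le :: "nat \<Rightarrow> nat \<Rightarrow> nat set list set rel" where
  "Bruhat_le n k = closure_on (Bruhat n k) (Bruhat_cover n k)"

definition coBruhat :: "nat \<Rightarrow> nat \<Rightarrow> nat set list set set" where
  "coBruhat n k = {\<rho>. coadmissible n k \<rho>} // comm_eq"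

definition coBruhat_cover :: "nat \<Rightarrow> nat \<Rightarrow> nat set list set rel" where
  "coBruhat_cover n k = {(C, D). C \<in> coBruhat n k \<and> D \<in> coBruhat n k \<and>
     (\<exists>\<rho> \<in> C. \<exists>\<sigma> \<in> D. \<exists>X \<in> nsets_pred n k. (\<rho>, \<sigma>) \<in> block_reversal (copacket n X))}"

definition coBruhat_le :: "nat \<Rightarrow> nat \<Rightarrow> nat set list set rel" where
  "coBruhat_le n k = closure_on (coBruhat n k) (coBruhat_cover n k)"

definition lex_prefix :: "nat set set \<Rightarrow> nat set set \<Rightarrow> bool" where
  "lex_prefix J Q \<longleftrightarrow> J \<subseteq> Q \<and> (\<forall>Y \<in> J. \<forall>Z \<in> Q. lex_less Z Y \<longrightarrow> Z \<in> J)"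

definition lex_suffix :: "nat set set \<Rightarrow> nat set set \<Rightarrow> bool" where
  "lex_suffix J Q \<longleftrightarrow> J \<subseteq> Q \<and> (\<forall>Y \<in> J. \<forall>Z \<in> Q. lex_less Y Z \<longrightarrow> Z \<in> J)"

definition consistent :: "nat \<Rightarrow> nat \<Rightarrow> nat set set \<Rightarrow> bool" where
  "consistent n k I \<longleftrightarrow> I \<subseteq> [{1..n}]\<^bsup>k\<^esup> \<and>
     (\<forall>X \<in> [{1..n}]\<^bsup>Suc k\<^esup>. lex_prefix (packet X \<inter> I) (packet X) \<or>
                              lex_suffix (packet X \<inter> I) (packet X))"

definition coconsistent :: "nat \<Rightarrow> nat \<Rightarrow> nat set set \<Rightarrow> bool" where
  "coconsistent n k I \<longleftrightarrow> I \<subseteq> [{1..n}]\<^bsup>k\<^esup> \<and>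
     (\<forall>X \<in> nsets_pred n k. lex_prefix (copacket n X \<inter> I) (copacket n X) \<or>
                           lex_suffix (copacket n X \<inter> I) (copacket n X))"

definition Cons_sets :: "nat \<Rightarrow> nat \<Rightarrow> nat set set set" where
  "Cons_sets n k = {I. consistent n k I}"

definition coCons_sets :: "nat \<Rightarrow> nat \<Rightarrow> nat set set set" where
  "coCons_sets n k = {I. coconsistent n k I}"

definition single_step :: "'a set set \<Rightarrow> 'a set rel" where
  "single_step S = {(I, J). I \<in> S \<and> J \<in> S \<and> (\<exists>y. y \<notin> I \<and> J = I \<union> {y})}"

definition Cons_le :: "nat \<Rightarrow> nat \<Rightarrow> nat set set rel" where
  "Cons_le n k = closure_on (Cons_sets n k) (single_step (Cons_sets n k))"

definition coCons_le :: "nat \<Rightarrow> nat \<Rightarrow> nat set set rel" where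
  "coCons_le n k = closure_on (coCons_sets n k) (single_step (coCons_sets n k))"


subsection \<open>The maps\<close>

text \<open>
  Each map on commutation classes is induced by a map on orders (suffix \<open>_ord\<close>):
  its value at a class is the common value at all representatives.
\<close>

definition Rev_ord :: "nat \<Rightarrow> nat \<Rightarrow> nat set list \<Rightarrow> nat set set" where
  "Rev_ord n k \<rho> = {X \<in> [{1..n}]\<^bsup>Suc k\<^esup>. antilex_sorted (restrict_order \<rho> (packet X))}"

definition Rev :: "nat \<Rightarrow> nat \<Rightarrow> nat set list set \<Rightarrow> nat set set" where
  "Rev n k C = the_elem (Rev_ord n k ` C)"

definition Corev_ord :: "nat \<Rightarrow> nat \<Rightarrow> nat set list \<Rightarrow> nat set set" where
  "Corev_ord n k \<rho> = {X \<in> nsets_pred n k. antilex_sorted (restrict_order \<rho> (copacket n X))}"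

definition Corev :: "nat \<Rightarrow> nat \<Rightarrow> nat set list set \<Rightarrow> nat set set" where
  "Corev n k C = the_elem (Corev_ord n k ` C)"

definition beta_ord :: "nat \<Rightarrow> nat set list \<Rightarrow> nat set list" where
  "beta_ord n \<rho> = rev (map (\<lambda>X. {1..n} - X) \<rho>)"

definition beta :: "nat \<Rightarrow> nat set list set \<Rightarrow> nat set list set" where
  "beta n C = the_elem ((\<lambda>\<rho>. comm_class (beta_ord n \<rho>)) ` C)"

definition gamma :: "nat \<Rightarrow> nat set set \<Rightarrow> nat set set" where
  "gamma n I = (\<lambda>X. {1..n} - X) ` I"


definition poset_iso :: "'a set \<Rightarrow> 'a rel \<Rightarrow> 'b set \<Rightarrow> 'b rel \<Rightarrow> ('a \<Rightarrow> 'b) \<Rightarrow> bool" where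
  "poset_iso A r B s f \<longleftrightarrow> partial_order_on A r \<and> partial_order_on B s \<and> bij_betw f A B \<and>
     (\<forall>x \<in> A. \<forall>y \<in> A. (x, y) \<in> r \<longleftrightarrow> (f x, f y) \<in> s)"

end

theory Submission
  imports Defs
begin

text \<open>
  A set \<open>I\<close> of \<open>(k+1)\<close>-sets orients every packet, lex outside \<open>I\<close> and antilex inside \<open>I\<close>; an order
  with reversal set \<open>I\<close> is a linear extension of these arcs. Non-commuting \<open>k\<close>-sets are always joined
  by an arc, so two linear extensions are commutation equivalent, which makes \<open>Rev\<close> injective. An
  alternating triple \<open>a < b < c\<close> in a \<open>(k+2)\<close>-set would give a 3-cycle of arcs, so reversal sets are
  consistent; conversely, the arcs of a consistent set are acyclic by induction on \<open>n\<close>, via deletion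
  and contraction of the largest element. If \<open>I\<close> and \<open>insert X I\<close> are both consistent, acyclicity for
  both makes the packet of \<open>X\<close> convex in the order generated by \<open>I\<close>, so that it can be made consecutive
  and reversed. The dual statements follow by taking complements.
\<close>


subsection \<open>Lexicographic order and sorted lists\<close>

text \<open>A commutation class is awkward to handle, since a cover only promises that some
  representative has a packet as a consecutive block. Phrasing everything through arcs removes this
  difficulty: for \<open>1 <= k\<close> a class consists of all linear extensions of the arcs of its
  reversal set, so that representatives can be built freely from the set alone. Acyclicity is never
  argued with paths in isolation; a linear extension supplies a rank function that increases along
  arcs, and cycles are refuted by adding up inequalities. Both sides of \<open>Rev\<close> are
  ordered by closures of cover relations, so a bijection that matches covers in both directions
  suffices. Antisymmetry, which is not visible in the definition of the order on classes, is
  inherited from inclusion of sets. On the dual side, complementation exchanges packets and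
  copackets but reverses lex on them, and the list reversal in \<open>beta_ord\<close> undoes this.
  \<open>Corev\<close> is then forced to be an isomorphism by the commuting square.\<close>

lemma insort_lexord:
  fixes x y :: nat
  assumes "x < y" "x \<notin> set zs"
  shows "(insort x zs, insort y zs) \<in> lexord less_than"
  using assms by (induction zs) auto

lemma lex_less_insert:
  assumes "finite Z" "x \<notin> Z" "y \<notin> Z"
  shows "lex_less (insert x Z) (insert y Z) \<longleftrightarrow> x < y"
proof -
  have less: "lex_less (insert u Z) (insert v Z)" if "u < v" "u \<notin> Z" "v \<notin> Z" for u v
    unfolding lex_less_def using that assms(1) insort_lexord by simp
  have "asym (lexord less_than :: nat list rel)"
    by (intro lexord_asym wf_imp_asym wf_less_than)
  then have "\<not> lex_less (insert x Z) (insert y Z)" if "\<not> x < y"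
    using less[of y x] assms that unfolding lex_less_def
    by (cases "x = y") (auto dest: asymD)
  with less assms show ?thesis by blast
qed

text \<open>Removing \<open>x\<close> from \<open>X\<close> amounts to inserting \<open>y\<close>
  into \<open>X - {x, y}\<close>, which is why the inequality is turned around.\<close>

lemma lex_less_remove:
  assumes "finite X" "x \<in> X" "y \<in> X"
  shows "lex_less (X - {x}) (X - {y}) \<longleftrightarrow> y < x"
proof (cases "x = y")
  case False
  then have *: "X - {x} = insert y (X - {x, y})" "X - {y} = insert x (X - {x, y})"
    using assms by auto
  have "lex_less (insert y (X - {x, y})) (insert x (X - {x, y})) \<longleftrightarrow> y < x"
    using assms(1) by (intro lex_less_insert) auto
  then show ?thesis unfolding *[symmetric] .
next
  case True
  then show ?thesis by (simp add: lex_less_def lexord_irreflexive)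
qed

lemma sorted_wrt_filter_iff:
  "sorted_wrt R (filter P xs) \<longleftrightarrow> sorted_wrt (\<lambda>x y. P x \<longrightarrow> P y \<longrightarrow> R x y) xs"
  by (induction xs) auto

lemma sorted_wrt_mono_distinct:
  assumes "sorted_wrt P xs" "distinct xs"
    and "\<And>x y. x \<in> set xs \<Longrightarrow> y \<in> set xs \<Longrightarrow> x \<noteq> y \<Longrightarrow> P x y \<Longrightarrow> Q x y"
  shows "sorted_wrt Q xs"
  using assms by (induction xs) auto

text \<open>The position in the list is a potential for \<open>A\<close>. It later turns arguments
  about cycles of arcs into inequalities between numbers.\<close>

lemma sorted_wrt_rank:
  assumes "sorted_wrt (\<lambda>x y. (y, x) \<notin> A) xs" "distinct xs"
  shows "\<exists>f :: 'a \<Rightarrow> nat. \<forall>x \<in> set xs. \<forall>y \<in> set xs. (x, y) \<in> A \<longrightarrow> x \<noteq> y \<longrightarrow> f x < f y"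
  using assms
proof (induction xs)
  case (Cons a xs)
  then obtain f :: "'a \<Rightarrow> nat"
    where "\<forall>x \<in> set xs. \<forall>y \<in> set xs. (x, y) \<in> A \<longrightarrow> x \<noteq> y \<longrightarrow> f x < f y"
    by auto
  with Cons.prems show ?case
    by (intro exI[of _ "\<lambda>x. if x = a then 0 else Suc (f x)"]) auto
qed simp

lemma total_orders_iff: "\<rho> \<in> total_orders n k \<longleftrightarrow> set \<rho> = [{1..n}]\<^bsup>k\<^esup> \<and> distinct \<rho>"
  by (auto simp: total_orders_def permutations_of_set_def)


subsection \<open>Commutation classes\<close>

lemma commute_sym: "commute X Y \<Longrightarrow> commute Y X"
  by (auto simp: commute_def)

lemma packet_not_commute:
  assumes "X \<in> packet Z" "Y \<in> packet Z" "X \<noteq> Y"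
  shows "\<not> commute X Y"
proof -
  from assms obtain x y where "x \<in> Z" "X = Z - {x}" "y \<in> Z" "Y = Z - {y}" "x \<noteq> y"
    by (auto simp: packet_def)
  then have "Z - {x, y} \<in> packet X \<inter> packet Y" by (auto simp: packet_def)
  then show ?thesis by (auto simp: commute_def)
qed

lemma copacket_not_commute:
  assumes "X \<in> copacket n Z" "Y \<in> copacket n Z"
  shows "\<not> commute X Y"
proof -
  from assms obtain x y where "x \<notin> Z" "X = insert x Z" "y \<notin> Z" "Y = insert y Z"
    by (auto simp: copacket_def)
  then have "Z \<in> packet X \<inter> packet Y" by (auto simp: packet_def)
  then show ?thesis by (auto simp: commute_def)
qed

lemma equiv_comm_eq: "equiv UNIV comm_eq"
proof -
  have "sym comm_step"
    unfolding comm_step_def by (rule symI) (blast intro: commute_sym)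
  then show ?thesis
    by (auto simp: comm_eq_def equiv_def refl_on_def sym_rtrancl trans_rtrancl)
qed

lemma comm_class_eq_iff: "comm_class \<rho> = comm_class \<sigma> \<longleftrightarrow> (\<rho>, \<sigma>) \<in> comm_eq"
  unfolding comm_class_def using eq_equiv_class_iff[OF equiv_comm_eq] by simp

lemma mem_comm_class: "\<sigma> \<in> comm_class \<rho> \<longleftrightarrow> (\<rho>, \<sigma>) \<in> comm_eq"
  by (simp add: comm_class_def)

lemma self_mem_comm_class: "\<rho> \<in> comm_class \<rho>"
  by (simp add: mem_comm_class comm_eq_def)

lemma comm_step_total_orders:
  assumes "(\<rho>, \<sigma>) \<in> comm_step" "\<rho> \<in> total_orders n k"
  shows "\<sigma> \<in> total_orders n k"
proof -
  have "set \<sigma> = set \<rho> \<and> distinct \<sigma> = distinct \<rho>"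
    using assms(1) unfolding comm_step_def by auto
  with assms(2) show ?thesis by (simp add: total_orders_iff)
qed

lemma comm_eq_total_orders:
  assumes "(\<rho>, \<sigma>) \<in> comm_eq" "\<rho> \<in> total_orders n k"
  shows "\<sigma> \<in> total_orders n k"
  using assms(1) unfolding comm_eq_def
  by (induction rule: rtrancl_induct) (use assms(2) comm_step_total_orders in auto)

text \<open>A transposition of commuting elements never swaps two distinct members of
  \<open>Q\<close>, so the filtered list does not notice it. Packets and copackets are such sets
  \<open>Q\<close>, which makes admissibility and the reversed packets invariants of the
  class.\<close>

lemma comm_eq_restrict_order:
  assumes "(\<rho>, \<sigma>) \<in> comm_eq"
    and "\<And>X Y. X \<in> Q \<Longrightarrow> Y \<in> Q \<Longrightarrow> X \<noteq> Y \<Longrightarrow> \<not> commute X Y"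
  shows "restrict_order \<sigma> Q = restrict_order \<rho> Q"
  using assms(1) unfolding comm_eq_def
proof (induction rule: rtrancl_induct)
  case (step \<sigma> \<tau>)
  then obtain us vs X Y where "commute X Y" "\<sigma> = us @ [X, Y] @ vs" "\<tau> = us @ [Y, X] @ vs"
    unfolding comm_step_def by blast
  \<comment> \<open>The empty set commutes with itself, so a step may have \<open>X = Y\<close>; it
    then changes nothing.\<close>
  moreover from this have "X = Y \<or> X \<notin> Q \<or> Y \<notin> Q" using assms(2) by blast
  ultimately show ?case using step.IH by (auto simp: restrict_order_def)
qed simp

lemma comm_eq_admissible:
  assumes "(\<rho>, \<sigma>) \<in> comm_eq" "admissible n k \<rho>"
  shows "admissible n k \<sigma> \<and> Rev_ord n k \<sigma> = Rev_ord n k \<rho>"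
proof -
  have "restrict_order \<sigma> (packet X) = restrict_order \<rho> (packet X)" for X
    using assms(1) packet_not_commute by (rule comm_eq_restrict_order)
  with assms comm_eq_total_orders show ?thesis
    by (auto simp: admissible_def Rev_ord_def)
qed

lemma comm_eq_coadmissible:
  assumes "(\<rho>, \<sigma>) \<in> comm_eq" "coadmissible n k \<rho>"
  shows "coadmissible n k \<sigma> \<and> Corev_ord n k \<sigma> = Corev_ord n k \<rho>"
proof -
  have "restrict_order \<sigma> (copacket n X) = restrict_order \<rho> (copacket n X)" for X
    using assms(1) copacket_not_commute by (rule comm_eq_restrict_order)
  with assms comm_eq_total_orders show ?thesis
    by (auto simp: coadmissible_def Corev_ord_def)
qed

lemma the_elem_image_comm_class:
  assumes "\<And>\<sigma>. (\<rho>, \<sigma>) \<in> comm_eq \<Longrightarrow> f \<sigma> = f \<rho>"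
  shows "the_elem (f ` comm_class \<rho>) = f \<rho>"
proof -
  have "f ` comm_class \<rho> = {f \<rho>}"
  proof (intro equalityI subsetI)
    fix y assume "y \<in> f ` comm_class \<rho>"
    then obtain \<sigma> where "y = f \<sigma>" "(\<rho>, \<sigma>) \<in> comm_eq" by (auto simp: mem_comm_class)
    then show "y \<in> {f \<rho>}" using assms by simp
  qed (simp add: self_mem_comm_class)
  then show ?thesis by simp
qed

lemma Rev_comm_class:
  assumes "admissible n k \<rho>"
  shows "Rev n k (comm_class \<rho>) = Rev_ord n k \<rho>"
proof -
  have "Rev_ord n k \<sigma> = Rev_ord n k \<rho>" if "(\<rho>, \<sigma>) \<in> comm_eq" for \<sigma>
    using comm_eq_admissible[OF that assms] ..
  then show ?thesis unfolding Rev_def by (rule the_elem_image_comm_class)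
qed

lemma Corev_comm_class:
  assumes "coadmissible n k \<rho>"
  shows "Corev n k (comm_class \<rho>) = Corev_ord n k \<rho>"
proof -
  have "Corev_ord n k \<sigma> = Corev_ord n k \<rho>" if "(\<rho>, \<sigma>) \<in> comm_eq" for \<sigma>
    using comm_eq_coadmissible[OF that assms] ..
  then show ?thesis unfolding Corev_def by (rule the_elem_image_comm_class)
qed

lemma Bruhat_eq: "Bruhat n k = comm_class ` {\<rho>. admissible n k \<rho>}"
  by (auto simp: Bruhat_def quotient_def comm_class_def)

lemma coBruhat_eq: "coBruhat n k = comm_class ` {\<rho>. coadmissible n k \<rho>}"
  by (auto simp: coBruhat_def quotient_def comm_class_def)

lemma Bruhat_mem:
  assumes "C \<in> Bruhat n k" "\<rho> \<in> C"
  shows "admissible n k \<rho>" "C = comm_class \<rho>"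
proof -
  from assms obtain \<rho>' where "C = comm_class \<rho>'" "admissible n k \<rho>'" "(\<rho>', \<rho>) \<in> comm_eq"
    by (auto simp: Bruhat_eq mem_comm_class)
  then show "admissible n k \<rho>" "C = comm_class \<rho>"
    using comm_eq_admissible by (auto simp: comm_class_eq_iff)
qed

lemma coBruhat_mem:
  assumes "C \<in> coBruhat n k" "\<rho> \<in> C"
  shows "coadmissible n k \<rho>" "C = comm_class \<rho>"
proof -
  from assms obtain \<rho>' where "C = comm_class \<rho>'" "coadmissible n k \<rho>'" "(\<rho>', \<rho>) \<in> comm_eq"
    by (auto simp: coBruhat_eq mem_comm_class)
  then show "coadmissible n k \<rho>" "C = comm_class \<rho>"
    using comm_eq_coadmissible by (auto simp: comm_class_eq_iff)
qed

lemma comm_eq_Cons: "(\<rho>, \<sigma>) \<in> comm_eq \<Longrightarrow> (X # \<rho>, X # \<sigma>) \<in> comm_eq"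
  unfolding comm_eq_def
proof (induction rule: rtrancl_induct)
  case (step \<sigma> \<tau>)
  then obtain us vs U V where "commute U V" "\<sigma> = us @ [U, V] @ vs" "\<tau> = us @ [V, U] @ vs"
    by (auto simp: comm_step_def)
  then have "X # \<sigma> = (X # us) @ [U, V] @ vs" "X # \<tau> = (X # us) @ [V, U] @ vs" "commute U V"
    by auto
  then have "(X # \<sigma>, X # \<tau>) \<in> comm_step" unfolding comm_step_def by blast
  with step.IH show ?case by simp
qed simp

lemma comm_eq_move_front:
  assumes "\<forall>u \<in> set us. commute u s"
  shows "(us @ s # vs, s # us @ vs) \<in> comm_eq"
  using assms
proof (induction us)
  case Nil
  then show ?case by (simp add: comm_eq_def)
next
  case (Cons u us)
  then have "(u # us @ s # vs, u # s # us @ vs) \<in> comm_eq" using comm_eq_Cons by simp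
  moreover have "([] @ [u, s] @ us @ vs, [] @ [s, u] @ us @ vs) \<in> comm_step"
    using Cons.prems unfolding comm_step_def by fastforce
  ultimately show ?case by (simp add: comm_eq_def)
qed

text \<open>Induction on the length: no arc prevents the first element of one order from being moved to the
  front of the other.\<close>

lemma comm_eq_if_sorted_wrt:
  assumes "distinct \<rho>" "distinct \<sigma>" "set \<rho> = set \<sigma>"
    and "sorted_wrt (\<lambda>U V. (V, U) \<notin> A) \<rho>" "sorted_wrt (\<lambda>U V. (V, U) \<notin> A) \<sigma>"
    and "\<And>U V. U \<in> set \<sigma> \<Longrightarrow> V \<in> set \<sigma> \<Longrightarrow> U \<noteq> V \<Longrightarrow> \<not> commute U V \<Longrightarrow> (U, V) \<in> A \<or> (V, U) \<in> A"
  shows "(\<rho>, \<sigma>) \<in> comm_eq"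
  using assms
proof (induction \<sigma> arbitrary: \<rho>)
  case Nil
  then show ?case by (simp add: comm_eq_def)
next
  case (Cons s \<sigma>)
  obtain us vs where \<rho>: "\<rho> = us @ s # vs"
    using Cons.prems(3) by (metis list.set_intros(1) split_list)
  have set_eq: "set (us @ vs) = set \<sigma>" using Cons.prems(1-3) \<rho> by auto
  \<comment> \<open>\<open>u\<close> stands before \<open>s\<close> in \<open>\<rho>\<close> and
    after \<open>s\<close> in \<open>s # \<sigma>\<close>, so an arc in either direction would be
    violated by one of the two orders.\<close>
  have "commute u s" if "u \<in> set us" for u
  proof -
    have "u \<in> set (s # \<sigma>)" "u \<in> set \<sigma>" "u \<noteq> s" "(s, u) \<notin> A"
      using that set_eq Cons.prems(1,4) by (auto simp: \<rho> sorted_wrt_append)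
    moreover have "(u, s) \<notin> A" using Cons.prems(5) \<open>u \<in> set \<sigma>\<close> by simp
    ultimately show ?thesis using Cons.prems(6)[of u s] by auto
  qed
  then have "(\<rho>, s # us @ vs) \<in> comm_eq" using \<rho> comm_eq_move_front by simp
  moreover have "(us @ vs, \<sigma>) \<in> comm_eq"
  proof (rule Cons.IH)
    show "distinct (us @ vs)" "sorted_wrt (\<lambda>U V. (V, U) \<notin> A) (us @ vs)"
      using Cons.prems(1,4) by (auto simp: \<rho> sorted_wrt_append)
    show "distinct \<sigma>" "sorted_wrt (\<lambda>U V. (V, U) \<notin> A) \<sigma>"
      using Cons.prems(2,5) by auto
    show "(U, V) \<in> A \<or> (V, U) \<in> A"
      if "U \<in> set \<sigma>" "V \<in> set \<sigma>" "U \<noteq> V" "\<not> commute U V" for U V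
      using Cons.prems(6) that by simp
  qed (rule set_eq)
  ultimately show ?case
    using comm_eq_Cons[of "us @ vs" \<sigma> s] unfolding comm_eq_def
    by (metis append_Cons rtrancl_trans)
qed


subsection \<open>Orders with a prescribed set of reversed packets\<close>

text \<open>An arc from \<open>U\<close> to \<open>V\<close> demands that \<open>U\<close> come
  first. Removing a larger element gives a lex smaller set, so outside \<open>I\<close> the arcs
  follow lex. Neither \<open>n\<close> nor \<open>k\<close> enters, hence the same relation serves
  all ground sets and set sizes met in the induction.\<close>

definition arcs :: "nat set set \<Rightarrow> nat set rel" where
  "arcs I = {(X - {x}, X - {y}) | X x y. x \<in> X \<and> y \<in> X \<and> (if X \<in> I then x < y else y < x)}"

text \<open>Unlike prescribing \<open>Rev_ord\<close> for an admissible order, this is also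
  meaningful for \<open>k = 0\<close>, where lex and antilex coincide on every packet. The induction
  on the ground set lowers \<open>k\<close> and reaches that case.\<close>

definition realizes :: "nat \<Rightarrow> nat \<Rightarrow> nat set set \<Rightarrow> nat set list \<Rightarrow> bool" where
  "realizes n k I \<rho> \<longleftrightarrow> \<rho> \<in> total_orders n k \<and> sorted_wrt (\<lambda>U V. (V, U) \<notin> arcs I) \<rho>"

lemma arcsE:
  assumes "(U, V) \<in> arcs I"
  obtains X x y where "U = X - {x}" "V = X - {y}" "x \<in> X" "y \<in> X" "x \<noteq> y" "X = U \<union> V"
    "if X \<in> I then x < y else y < x"
proof -
  from assms obtain X x y where *: "U = X - {x}" "V = X - {y}" "x \<in> X" "y \<in> X"
    "if X \<in> I then x < y else y < x"
    unfolding arcs_def by blast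
  then have "x \<noteq> y" by (auto split: if_splits)
  moreover from this * have "X = U \<union> V" by blast
  ultimately show thesis using that * by metis
qed

text \<open>The witnesses of an arc are unique: the big set is the union of the endpoints, and the
  removed elements are those that each endpoint lacks.\<close>

lemma arcs_iff:
  assumes "x \<in> X" "y \<in> X"
  shows "(X - {x}, X - {y}) \<in> arcs I \<longleftrightarrow> (if X \<in> I then x < y else y < x)"
proof
  assume "(X - {x}, X - {y}) \<in> arcs I"
  then obtain Z u v where Z: "X - {x} = Z - {u}" "X - {y} = Z - {v}" "u \<in> Z" "v \<in> Z" "u \<noteq> v"
    "Z = (X - {x}) \<union> (X - {y})" and Z_I: "if Z \<in> I then u < v else v < u"
    by (elim arcsE)
  have "Z - {u} \<noteq> Z - {v}" using Z(3,5) by blast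
  then have "x \<noteq> y" using Z(1,2) by metis
  then have "(X - {x}) \<union> (X - {y}) = X" by blast
  then have "X = Z" using Z(6) by metis
  have "u = x" "v = y"
    using Z(1-4) assms unfolding \<open>X = Z\<close> by (metis Diff_iff singletonD singletonI)+
  with \<open>X = Z\<close> Z_I show "if X \<in> I then x < y else y < x" by (simp split: if_splits)
next
  assume "if X \<in> I then x < y else y < x"
  then show "(X - {x}, X - {y}) \<in> arcs I" using assms unfolding arcs_def by blast
qed

text \<open>The union of the endpoints is the only set at which the family is consulted. This is the
  tool for comparing the arcs of families that agree except at a few sets.\<close>

lemma arcs_cong: "(U \<union> V \<in> I \<longleftrightarrow> U \<union> V \<in> J) \<Longrightarrow> (U, V) \<in> arcs I \<longleftrightarrow> (U, V) \<in> arcs J"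
proof -
  have "(U, V) \<in> arcs J" if "(U, V) \<in> arcs I" and IJ: "U \<union> V \<in> I \<longleftrightarrow> U \<union> V \<in> J" for I J
  proof -
    from that(1) obtain X x y where UV: "U = X - {x}" "V = X - {y}"
      and X: "x \<in> X" "y \<in> X" "X = U \<union> V" "if X \<in> I then x < y else y < x"
      by (elim arcsE)
    have "X \<in> I \<longleftrightarrow> X \<in> J" using IJ unfolding X(3)[symmetric] .
    with X(1,2,4) show ?thesis unfolding UV by (simp add: arcs_iff)
  qed
  then show "U \<union> V \<in> I \<longleftrightarrow> U \<union> V \<in> J \<Longrightarrow> (U, V) \<in> arcs I \<longleftrightarrow> (U, V) \<in> arcs J" by blast
qed

lemma packet_subset_nsets: "X \<in> [{1..n}]\<^bsup>Suc k\<^esup> \<Longrightarrow> packet X \<subseteq> [{1..n}]\<^bsup>k\<^esup>"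
  by (auto simp: packet_def nsets_def)

lemma arcs_union_nsets:
  assumes "(U, V) \<in> arcs I" "U \<in> [{1..n}]\<^bsup>k\<^esup>" "V \<in> [{1..n}]\<^bsup>k\<^esup>"
  shows "U \<union> V \<in> [{1..n}]\<^bsup>Suc k\<^esup>" "U \<in> packet (U \<union> V)" "V \<in> packet (U \<union> V)"
proof -
  from assms(1) obtain X x y where X: "U = X - {x}" "V = X - {y}" "x \<in> X" "y \<in> X"
    and union: "X = U \<union> V"
    by (elim arcsE)
  have *: "finite (X - {x})" "card (X - {x}) = k" "X - {x} \<subseteq> {1..n}" "X - {y} \<subseteq> {1..n}"
    using assms(2,3) unfolding X nsets_def by blast+
  have "finite X" using *(1) by simp
  then have "card X = Suc k" using card_Suc_Diff1[OF _ X(3)] *(2) by metis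
  with \<open>finite X\<close> have "X \<in> [{1..n}]\<^bsup>Suc k\<^esup>"
    using assms(2,3) union by (simp add: nsets_def)
  then show "U \<union> V \<in> [{1..n}]\<^bsup>Suc k\<^esup>" unfolding union .
  have "U \<in> packet X" "V \<in> packet X" using X by (auto simp: packet_def)
  then show "U \<in> packet (U \<union> V)" "V \<in> packet (U \<union> V)" unfolding union[symmetric] .
qed

text \<open>Distinct sets with a common packet member differ by the exchange of one element, so both
  lie in the packet of their union, and every packet is totally oriented.\<close>

lemma not_commute_arcs:
  assumes "U \<noteq> V" "\<not> commute U V"
  shows "(U, V) \<in> arcs I \<or> (V, U) \<in> arcs I"
proof -
  from assms(2) obtain a b where ab: "a \<in> U" "b \<in> V" "U - {a} = V - {b}"
    by (auto simp: commute_def packet_def)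
  then have "a \<noteq> b" using assms(1) by blast
  define X where "X = insert a V"
  have "U = insert a (U - {a})" using ab(1) by blast
  also have "\<dots> = insert a (V - {b})" by (simp only: ab(3))
  finally have U: "U = X - {b}" using \<open>a \<noteq> b\<close> unfolding X_def by blast
  have "a \<notin> V - {b}" by (simp add: ab(3)[symmetric])
  then have V: "V = X - {a}" using \<open>a \<noteq> b\<close> unfolding X_def by blast
  have "a \<in> X" "b \<in> X" using ab(2) by (simp_all add: X_def)
  then have "(X - {b}, X - {a}) \<in> arcs I \<or> (X - {a}, X - {b}) \<in> arcs I"
    using \<open>a \<noteq> b\<close> by (auto simp: arcs_iff)
  then show ?thesis unfolding U[symmetric] V[symmetric] .
qed

lemma packet_arcs_iff:
  assumes "finite X" "U \<in> packet X" "V \<in> packet X" "U \<noteq> V"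
  shows "(U, V) \<in> arcs I \<longleftrightarrow> (if X \<in> I then lex_less V U else lex_less U V)"
  using assms by (auto simp: packet_def arcs_iff lex_less_remove)

lemma packet_lex_total:
  assumes "finite X" "U \<in> packet X" "V \<in> packet X"
  shows "lex_less U V \<longleftrightarrow> U \<noteq> V \<and> \<not> lex_less V U"
proof -
  from assms obtain x y where UV: "x \<in> X" "U = X - {x}" "y \<in> X" "V = X - {y}"
    by (auto simp: packet_def)
  then have "U = V \<longleftrightarrow> x = y" by (metis Diff_iff singletonD singletonI)
  moreover have "lex_less U V \<longleftrightarrow> y < x" "lex_less V U \<longleftrightarrow> x < y"
    using assms(1) UV by (simp_all add: lex_less_remove)
  ultimately show ?thesis by auto
qed

text \<open>With \<open>1 <= k\<close> a packet has at least two members, and these cannot be in lex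
  and in antilex order at once.\<close>

lemma restrict_lex_iff_not_antilex:
  assumes "X \<in> [{1..n}]\<^bsup>Suc k\<^esup>" "1 \<le> k" "\<rho> \<in> total_orders n k"
    and "lex_sorted (restrict_order \<rho> (packet X))"
  shows "\<not> antilex_sorted (restrict_order \<rho> (packet X))"
proof
  assume anti: "antilex_sorted (restrict_order \<rho> (packet X))"
  let ?bs = "restrict_order \<rho> (packet X)"
  have fin: "finite X" "card X = Suc k" using assms(1) by (auto simp: nsets_def)
  have set_bs: "set ?bs = packet X"
    using assms(1,3) packet_subset_nsets by (fastforce simp: restrict_order_def total_orders_iff)
  have "\<not> card X \<le> Suc 0" using fin(2) assms(2) by simp
  then obtain x y where "x \<in> X" "y \<in> X" "x \<noteq> y"
    using card_le_Suc0_iff_eq[OF fin(1)] by blast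
  then have "X - {x} \<in> set ?bs" "X - {y} \<in> set ?bs" "X - {x} \<noteq> X - {y}"
    unfolding set_bs by (auto simp: packet_def)
  moreover have "sorted_wrt (\<lambda>U V. lex_less U V \<and> lex_less V U) ?bs"
    using assms(4) anti by (simp add: lex_sorted_def antilex_sorted_def sorted_wrt_iff_nth_less)
  then have "sorted_wrt (\<lambda>U V. False) ?bs"
    by (rule sorted_wrt_mono_rel[rotated]) (use packet_lex_total[OF fin(1)] set_bs in blast)
  \<comment> \<open>\<open>remdups_adj.cases\<close> only provides the split into empty, singleton
    and longer lists; a longer list contradicts sortedness under a relation that never
    holds.\<close>
  then have "U = V" if "U \<in> set ?bs" "V \<in> set ?bs" for U V
    using that by (cases ?bs rule: remdups_adj.cases) auto
  ultimately show False by blast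
qed

text \<open>Every arc between \<open>k\<close>-sets lies within a single packet, that of the union
  of its endpoints. Absence of backward arcs can therefore be checked packet by packet.\<close>

lemma sorted_wrt_packets_iff:
  assumes "\<rho> \<in> total_orders n k"
  shows "sorted_wrt (\<lambda>U V. (V, U) \<notin> arcs I) \<rho> \<longleftrightarrow>
    (\<forall>X \<in> [{1..n}]\<^bsup>Suc k\<^esup>. if X \<in> I then antilex_sorted (restrict_order \<rho> (packet X))
                              else lex_sorted (restrict_order \<rho> (packet X)))"
    (is "_ \<longleftrightarrow> (\<forall>X \<in> _. ?R X)")
proof -
  have \<rho>: "set \<rho> = [{1..n}]\<^bsup>k\<^esup>" "distinct \<rho>" using assms by (auto simp: total_orders_iff)
  have R: "?R X \<longleftrightarrow> sorted_wrt (\<lambda>U V. U \<in> packet X \<longrightarrow> V \<in> packet X \<longrightarrow> (V, U) \<notin> arcs I) \<rho>"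
    if "X \<in> [{1..n}]\<^bsup>Suc k\<^esup>" for X
  proof -
    have fin: "finite X" using that by (auto simp: nsets_def)
    have "?R X \<longleftrightarrow> sorted_wrt (\<lambda>U V. U \<in> packet X \<longrightarrow> V \<in> packet X \<longrightarrow>
        (if X \<in> I then lex_less V U else lex_less U V)) \<rho>"
      by (auto simp: lex_sorted_def antilex_sorted_def restrict_order_def sorted_wrt_filter_iff)
    also have "\<dots> \<longleftrightarrow> sorted_wrt (\<lambda>U V. U \<in> packet X \<longrightarrow> V \<in> packet X \<longrightarrow> (V, U) \<notin> arcs I) \<rho>"
    proof -
      have "(if X \<in> I then lex_less V U else lex_less U V) \<longleftrightarrow> (V, U) \<notin> arcs I"
        if "U \<in> packet X" "V \<in> packet X" "U \<noteq> V" for U V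
        using packet_arcs_iff[OF fin that(2,1)] packet_lex_total[OF fin that(1,2)] that(3) by auto
      then show ?thesis
        by (intro iffI; elim sorted_wrt_mono_distinct) (use \<rho>(2) in auto)
    qed
    finally show ?thesis .
  qed
  have "sorted_wrt (\<lambda>U V. (V, U) \<notin> arcs I) \<rho> \<longleftrightarrow>
    sorted_wrt (\<lambda>U V. \<forall>X \<in> [{1..n}]\<^bsup>Suc k\<^esup>. U \<in> packet X \<longrightarrow> V \<in> packet X \<longrightarrow> (V, U) \<notin> arcs I) \<rho>"
  proof
    assume "sorted_wrt (\<lambda>U V. \<forall>X \<in> [{1..n}]\<^bsup>Suc k\<^esup>. U \<in> packet X \<longrightarrow> V \<in> packet X \<longrightarrow> (V, U) \<notin> arcs I) \<rho>"
    then show "sorted_wrt (\<lambda>U V. (V, U) \<notin> arcs I) \<rho>"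
      by (rule sorted_wrt_mono_rel[rotated]) (use arcs_union_nsets \<rho>(1) in blast)
  qed (erule sorted_wrt_mono_rel[rotated], simp)
  also have "\<dots> \<longleftrightarrow> (\<forall>X \<in> [{1..n}]\<^bsup>Suc k\<^esup>.
      sorted_wrt (\<lambda>U V. U \<in> packet X \<longrightarrow> V \<in> packet X \<longrightarrow> (V, U) \<notin> arcs I) \<rho>)"
    unfolding sorted_wrt_iff_nth_less by blast
  finally show ?thesis using R by simp
qed

lemma realizes_iff:
  assumes "1 \<le> k" "I \<subseteq> [{1..n}]\<^bsup>Suc k\<^esup>"
  shows "realizes n k I \<rho> \<longleftrightarrow> admissible n k \<rho> \<and> Rev_ord n k \<rho> = I"
proof (cases "\<rho> \<in> total_orders n k")
  case True
  have "\<not> antilex_sorted (restrict_order \<rho> (packet X))"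
    if "X \<in> [{1..n}]\<^bsup>Suc k\<^esup>" "lex_sorted (restrict_order \<rho> (packet X))" for X
    using restrict_lex_iff_not_antilex that assms(1) True by blast
  moreover have "realizes n k I \<rho> \<longleftrightarrow> (\<forall>X \<in> [{1..n}]\<^bsup>Suc k\<^esup>.
      if X \<in> I then antilex_sorted (restrict_order \<rho> (packet X))
      else lex_sorted (restrict_order \<rho> (packet X)))"
    using True sorted_wrt_packets_iff by (simp add: realizes_def)
  ultimately show ?thesis
    using True assms(2) by (auto simp: admissible_def Rev_ord_def split: if_splits)
qed (simp add: realizes_def admissible_def)

lemma realizes_Rev_ord: "1 \<le> k \<Longrightarrow> admissible n k \<rho> \<Longrightarrow> realizes n k (Rev_ord n k \<rho>) \<rho>"
  by (subst realizes_iff) (auto simp: Rev_ord_def)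

lemma realizes_comm_eq:
  assumes "realizes n k I \<rho>" "realizes n k I \<sigma>"
  shows "(\<rho>, \<sigma>) \<in> comm_eq"
proof (rule comm_eq_if_sorted_wrt)
  show "(U, V) \<in> arcs I \<or> (V, U) \<in> arcs I" if "U \<noteq> V" "\<not> commute U V" for U V
    using not_commute_arcs that .
qed (use assms in \<open>auto simp: realizes_def total_orders_iff\<close>)


subsection \<open>Consistent sets\<close>

text \<open>Along \<open>S\<close> the predicate changes its value at most once. The formula does
  not change when the order on \<open>S\<close> is reversed, so it covers prefixes and suffixes
  together, and packets as well as copackets.\<close>

definition between_closed :: "nat set \<Rightarrow> (nat \<Rightarrow> bool) \<Rightarrow> bool" where
  "between_closed S P \<longleftrightarrow>
     (\<forall>a \<in> S. \<forall>b \<in> S. \<forall>c \<in> S. a < b \<longrightarrow> b < c \<longrightarrow> P a = P c \<longrightarrow> P b = P a)"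

lemma between_closed_iff:
  "between_closed S P \<longleftrightarrow> (\<forall>a \<in> S. \<forall>b \<in> S. P a \<longrightarrow> a < b \<longrightarrow> P b) \<or>
     (\<forall>a \<in> S. \<forall>b \<in> S. P a \<longrightarrow> b < a \<longrightarrow> P b)" (is "_ \<longleftrightarrow> ?up \<or> ?down")
proof
  assume closed: "between_closed S P"
  show "?up \<or> ?down"
  proof (rule ccontr)
    assume "\<not> ?thesis"
    then obtain x y u v where "x \<in> S" "y \<in> S" "P x" "x < y" "\<not> P y"
      and "u \<in> S" "v \<in> S" "P v" "u < v" "\<not> P u"
      by blast
    \<comment> \<open>One of the forbidden alternations appears: \<open>x < y < v\<close> reads
      true, false, true, and \<open>u < v < y\<close> reads false, true, false.\<close>
    moreover have "y < v \<or> v < y" using \<open>P v\<close> \<open>\<not> P y\<close> by (metis linorder_neqE_nat)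
    ultimately show False using closed unfolding between_closed_def by blast
  qed
qed (unfold between_closed_def, blast)

text \<open>Copackets are parametrized increasingly by the inserted element and packets decreasingly
  by the removed one. Reversal merely exchanges prefix and suffix, so the disjunction is the same in
  both cases.\<close>

lemma prefix_suffix_iff:
  assumes "(\<forall>x \<in> S. \<forall>y \<in> S. lex_less (f x) (f y) \<longleftrightarrow> x < y) \<or>
    (\<forall>x \<in> S. \<forall>y \<in> S. lex_less (f x) (f y) \<longleftrightarrow> y < x)"
  shows "lex_prefix (f ` S \<inter> I) (f ` S) \<or> lex_suffix (f ` S \<inter> I) (f ` S) \<longleftrightarrow>
    between_closed S (\<lambda>x. f x \<in> I)"
proof -
  have "lex_prefix (f ` S \<inter> I) (f ` S) \<longleftrightarrow>
      (\<forall>a \<in> S. \<forall>b \<in> S. f a \<in> I \<longrightarrow> lex_less (f b) (f a) \<longrightarrow> f b \<in> I)"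
    "lex_suffix (f ` S \<inter> I) (f ` S) \<longleftrightarrow>
      (\<forall>a \<in> S. \<forall>b \<in> S. f a \<in> I \<longrightarrow> lex_less (f a) (f b) \<longrightarrow> f b \<in> I)"
    by (auto simp: lex_prefix_def lex_suffix_def)
  with assms show ?thesis unfolding between_closed_iff by auto
qed

lemma consistent_iff:
  "consistent n k I \<longleftrightarrow> I \<subseteq> [{1..n}]\<^bsup>k\<^esup> \<and>
     (\<forall>Y \<in> [{1..n}]\<^bsup>Suc k\<^esup>. between_closed Y (\<lambda>y. Y - {y} \<in> I))"
proof -
  have "lex_prefix (packet Y \<inter> I) (packet Y) \<or> lex_suffix (packet Y \<inter> I) (packet Y) \<longleftrightarrow>
    between_closed Y (\<lambda>y. Y - {y} \<in> I)" if "Y \<in> [{1..n}]\<^bsup>Suc k\<^esup>" for Y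
    unfolding packet_def
    by (rule prefix_suffix_iff) (use that in \<open>auto simp: nsets_def lex_less_remove\<close>)
  then show ?thesis by (simp add: consistent_def)
qed

lemma coconsistent_iff:
  "coconsistent n k I \<longleftrightarrow> I \<subseteq> [{1..n}]\<^bsup>k\<^esup> \<and>
     (\<forall>Z \<in> nsets_pred n k. between_closed ({1..n} - Z) (\<lambda>z. insert z Z \<in> I))"
proof -
  have "lex_prefix (copacket n Z \<inter> I) (copacket n Z) \<or> lex_suffix (copacket n Z \<inter> I) (copacket n Z)
    \<longleftrightarrow> between_closed ({1..n} - Z) (\<lambda>z. insert z Z \<in> I)" if "Z \<in> nsets_pred n k" for Z
    unfolding copacket_def
  proof (rule prefix_suffix_iff, rule disjI1, intro ballI)
    have "finite Z" using that finite_subset[of Z "{1..n}"] by (simp add: nsets_pred_def)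
    then show "lex_less (insert x Z) (insert y Z) \<longleftrightarrow> x < y"
      if "x \<in> {1..n} - Z" "y \<in> {1..n} - Z" for x y
      using that by (simp add: lex_less_insert)
  qed
  then show ?thesis by (simp add: coconsistent_def)
qed

section \<open>Reversal sets are consistent\<close>

lemma consistent_if_realizes:
  assumes "realizes n k I \<rho>" "I \<subseteq> [{1..n}]\<^bsup>Suc k\<^esup>"
  shows "consistent n (Suc k) I"
  unfolding consistent_iff between_closed_def
proof (intro conjI ballI impI)
  fix Y a b c
  assume Y: "Y \<in> [{1..n}]\<^bsup>Suc (Suc k)\<^esup>"
    and abc: "a \<in> Y" "b \<in> Y" "c \<in> Y" "a < b" "b < c"
    and ends: "(Y - {a} \<in> I) = (Y - {c} \<in> I)"
  obtain f :: "nat set \<Rightarrow> nat" where f: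
    "\<forall>U \<in> [{1..n}]\<^bsup>k\<^esup>. \<forall>V \<in> [{1..n}]\<^bsup>k\<^esup>. (U, V) \<in> arcs I \<longrightarrow> U \<noteq> V \<longrightarrow> f U < f V"
    using sorted_wrt_rank[of "arcs I" \<rho>] assms(1)
    by (auto simp: realizes_def total_orders_iff)
  \<comment> \<open>The set lacking \<open>x\<close> and \<open>y\<close> belongs to the packets of
    both \<open>Y - {x}\<close> and \<open>Y - {y}\<close>. So the three sets obtained from pairs
    among \<open>a\<close>, \<open>b\<close>, \<open>c\<close> are joined by three arcs, one for
    each of \<open>Y - {a}\<close>, \<open>Y - {b}\<close>, \<open>Y - {c}\<close>.\<close>
  define F where "F x y = f (Y - {x, y})" for x y
  have F_comm: "F x y = F y x" for x y by (simp add: F_def insert_commute)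
  have less: "F z x < F z y" if "x \<in> Y" "y \<in> Y" "z \<in> Y" "x \<noteq> z" "y \<noteq> z"
    "if Y - {z} \<in> I then x < y else y < x" for x y z
  proof -
    have eq: "Y - {z, x} = (Y - {z}) - {x}" "Y - {z, y} = (Y - {z}) - {y}" by auto
    have "Y - {z, x} \<in> [{1..n}]\<^bsup>k\<^esup>" "Y - {z, y} \<in> [{1..n}]\<^bsup>k\<^esup>"
      using Y that by (auto simp: nsets_def card_Diff_subset)
    moreover have "(Y - {z, x}, Y - {z, y}) \<in> arcs I"
      unfolding eq by (subst arcs_iff) (use that in auto)
    moreover have "Y - {z, x} \<noteq> Y - {z, y}" using that by (auto split: if_splits)
    ultimately show ?thesis using f unfolding F_def by blast
  qed
  show "(Y - {b} \<in> I) = (Y - {a} \<in> I)"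
  proof (rule ccontr)
    assume mid: "(Y - {b} \<in> I) \<noteq> (Y - {a} \<in> I)"
    show False
    proof (cases "Y - {a} \<in> I")
      case True
      then have "F a b < F a c" "F c a < F c b" "F b c < F b a"
        using mid ends abc by (auto intro!: less)
      then show False using F_comm[of a b] F_comm[of a c] F_comm[of b c] by linarith
    next
      case False
      then have "F a c < F a b" "F c b < F c a" "F b a < F b c"
        using mid ends abc by (auto intro!: less)
      then show False using F_comm[of a b] F_comm[of a c] F_comm[of b c] by linarith
    qed
  qed
qed (fact assms(2))


section \<open>Every consistent set has a linear extension\<close>

lemma nsets_Suc_eq:
  "[{1..Suc m}]\<^bsup>Suc k\<^esup> = [{1..m}]\<^bsup>Suc k\<^esup> \<union> insert (Suc m) ` [{1..m}]\<^bsup>k\<^esup>"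
  (is "?L = ?R \<union> ?S")
proof (intro equalityI subsetI)
  fix X assume X: "X \<in> ?L"
  show "X \<in> ?R \<union> ?S"
  proof (cases "Suc m \<in> X")
    case True
    then have "X - {Suc m} \<in> [{1..m}]\<^bsup>k\<^esup>" "X = insert (Suc m) (X - {Suc m})"
      using X by (auto simp: nsets_def)
    then show ?thesis by blast
  next
    case False
    then have "X \<subseteq> {1..m}"
      using X by (auto simp: nsets_def le_Suc_eq)
    then show ?thesis using X by (auto simp: nsets_def)
  qed
next
  fix X assume "X \<in> ?R \<union> ?S"
  then show "X \<in> ?L"
  proof
    assume "X \<in> ?S"
    then obtain Y where Y: "X = insert (Suc m) Y" "Y \<in> [{1..m}]\<^bsup>k\<^esup>" by blast
    moreover from this have "Suc m \<notin> Y" by (auto simp: nsets_def)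
    ultimately show ?thesis by (auto simp: nsets_def)
  qed (auto simp: nsets_def)
qed

text \<open>
  Induction on the ground set. With \<open>N = Suc m\<close> and \<open>J\<close> the link of \<open>N\<close> in \<open>I\<close>, consistency on the
  packets of the sets containing \<open>N\<close> says that no arc leads from a member of \<open>J\<close> to a non-member.
  The arcs between a \<open>k\<close>-set \<open>X\<close> avoiding \<open>N\<close> and \<open>k\<close>-sets through \<open>N\<close> all leave \<open>X\<close> if \<open>X \<notin> J\<close>, and
  all enter \<open>X\<close> if \<open>X \<in> J\<close>. So the sets through \<open>N\<close> fit between the non-members and the members of \<open>J\<close>.
\<close>

lemma consistent_imp_realizes:
  assumes "consistent n (Suc k) I"
  shows "\<exists>\<rho>. realizes n k I \<rho>"
  using assms
proof (induction n arbitrary: k I)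
  case (0 k I)
  show ?case
  proof (cases k)
    case 0
    have "realizes 0 0 I [{}]"
      by (auto simp: realizes_def total_orders_iff nsets_def)
    with 0 show ?thesis by blast
  next
    case (Suc k')
    have "realizes 0 k I []"
      by (auto simp: Suc realizes_def total_orders_iff nsets_def)
    then show ?thesis by blast
  qed
next
  case (Suc m k I)
  define N where "N = Suc m"
  have less_N: "x < N" if "x \<in> X" "X \<in> [{1..m}]\<^bsup>l\<^esup>" for x X l
    using that by (auto simp: nsets_def N_def)
  then have N_notin: "N \<notin> X" if "X \<in> [{1..m}]\<^bsup>l\<^esup>" for X l
    using that by blast
  have nsets_N: "X \<in> [{1..N}]\<^bsup>Suc l\<^esup> \<longleftrightarrow> X \<in> [{1..m}]\<^bsup>Suc l\<^esup> \<or> X \<in> insert N ` [{1..m}]\<^bsup>l\<^esup>" for X l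
    unfolding N_def nsets_Suc_eq by blast
  have closed: "between_closed Y (\<lambda>y. Y - {y} \<in> I)" if "Y \<in> [{1..N}]\<^bsup>Suc (Suc k)\<^esup>" for Y
    using Suc.prems that by (simp add: consistent_iff N_def)
  define I' where "I' = I \<inter> [{1..m}]\<^bsup>Suc k\<^esup>"
  have "consistent m (Suc k) I'"
    unfolding consistent_iff
  proof (intro conjI ballI)
    fix Y assume Y: "Y \<in> [{1..m}]\<^bsup>Suc (Suc k)\<^esup>"
    then have "Y - {y} \<in> I' \<longleftrightarrow> Y - {y} \<in> I" if "y \<in> Y" for y
      using that by (auto simp: I'_def nsets_def)
    with closed[of Y] nsets_N Y show "between_closed Y (\<lambda>y. Y - {y} \<in> I')"
      by (simp add: between_closed_def)
  qed (simp add: I'_def)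
  then obtain \<rho>\<^sub>1 where \<rho>\<^sub>1: "realizes m k I' \<rho>\<^sub>1" using Suc.IH by blast
  show ?case
  proof (cases k)
    case 0
    have "realizes N 0 I [{}]"
      by (auto simp: realizes_def total_orders_iff nsets_def)
    then show ?thesis unfolding 0 N_def by blast
  next
    case k: (Suc k')
    define J where "J = {X \<in> [{1..m}]\<^bsup>k\<^esup>. insert N X \<in> I}"
    have closed_N: "between_closed (insert N Y) (\<lambda>y. insert N Y - {y} \<in> I)"
      if "Y \<in> [{1..m}]\<^bsup>Suc k\<^esup>" for Y
      using closed nsets_N that by blast
    have J_iff: "insert N Y - {y} \<in> I \<longleftrightarrow> Y - {y} \<in> J"
      if "Y \<in> [{1..m}]\<^bsup>Suc k\<^esup>" "y \<in> Y" for y Y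
    proof -
      have "insert N Y - {y} = insert N (Y - {y})" using less_N[OF that(2,1)] by auto
      moreover have "Y - {y} \<in> [{1..m}]\<^bsup>k\<^esup>" using that by (auto simp: nsets_def)
      ultimately show ?thesis by (simp add: J_def)
    qed
    \<comment> \<open>For contraction, use the condition on \<open>insert N Y\<close> only at
      removals other than that of \<open>N\<close>.\<close>
    have "consistent m (Suc k') J"
      unfolding consistent_iff
    proof (intro conjI ballI)
      fix Y assume Y: "Y \<in> [{1..m}]\<^bsup>Suc (Suc k')\<^esup>"
      with closed_N[of Y] J_iff[of Y] show "between_closed Y (\<lambda>y. Y - {y} \<in> J)"
        by (simp add: between_closed_def k)
    qed (auto simp: J_def k)
    then obtain \<rho>\<^sub>2 where \<rho>\<^sub>2: "realizes m k' J \<rho>\<^sub>2" using Suc.IH by blast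
    have set1: "set \<rho>\<^sub>1 = [{1..m}]\<^bsup>k\<^esup>" "distinct \<rho>\<^sub>1" and set2: "set \<rho>\<^sub>2 = [{1..m}]\<^bsup>k'\<^esup>" "distinct \<rho>\<^sub>2"
      using \<rho>\<^sub>1 \<rho>\<^sub>2 by (auto simp: realizes_def total_orders_iff)
    define \<rho> where
      "\<rho> = filter (\<lambda>X. X \<notin> J) \<rho>\<^sub>1 @ map (insert N) \<rho>\<^sub>2 @ filter (\<lambda>X. X \<in> J) \<rho>\<^sub>1"
    have "\<rho> \<in> total_orders N k"
      unfolding total_orders_iff
    proof
      show "set \<rho> = [{1..N}]\<^bsup>k\<^esup>"
        unfolding k N_def nsets_Suc_eq using set1 set2 by (auto simp: \<rho>_def k N_def)
      have "inj_on (insert N) (set \<rho>\<^sub>2)"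
        by (rule inj_onI) (metis N_notin insert_ident set2(1))
      moreover have "set \<rho>\<^sub>1 \<inter> insert N ` set \<rho>\<^sub>2 = {}"
        using N_notin set1(1) by blast
      ultimately show "distinct \<rho>"
        using set1(2) set2(2) by (auto simp: \<rho>_def distinct_map)
    qed
    moreover have "sorted_wrt (\<lambda>U V. (V, U) \<notin> arcs I) \<rho>"
    proof -
      have old: "sorted_wrt (\<lambda>U V. (V, U) \<notin> arcs I) \<rho>\<^sub>1"
      proof -
        have "sorted_wrt (\<lambda>U V. (V, U) \<notin> arcs I') \<rho>\<^sub>1" using \<rho>\<^sub>1 by (simp add: realizes_def)
        then show ?thesis
        proof (rule sorted_wrt_mono_rel[rotated])
          fix U V assume UV: "U \<in> set \<rho>\<^sub>1" "V \<in> set \<rho>\<^sub>1" "(V, U) \<notin> arcs I'"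
          show "(V, U) \<notin> arcs I"
          proof
            assume arc: "(V, U) \<in> arcs I"
            then have "V \<union> U \<in> [{1..m}]\<^bsup>Suc k\<^esup>" using UV set1 arcs_union_nsets by simp
            then have "V \<union> U \<in> I \<longleftrightarrow> V \<union> U \<in> I'" by (simp add: I'_def)
            with arc UV(3) arcs_cong[of V U I I'] show False by simp
          qed
        qed
      qed
      have new: "sorted_wrt (\<lambda>U V. (V, U) \<notin> arcs I) (map (insert N) \<rho>\<^sub>2)"
      proof -
        have "sorted_wrt (\<lambda>U V. (V, U) \<notin> arcs J) \<rho>\<^sub>2" using \<rho>\<^sub>2 by (simp add: realizes_def)
        \<comment> \<open>An arc between two sets through \<open>N\<close> comes from a set
          \<open>insert N Y\<close>, and \<open>insert N Y\<close> is in \<open>I\<close> exactly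
          when \<open>Y\<close> is in \<open>J\<close>; deleting \<open>N\<close> therefore gives an
          arc of \<open>J\<close>.\<close>
        then have "sorted_wrt (\<lambda>U V. (insert N V, insert N U) \<notin> arcs I) \<rho>\<^sub>2"
        proof (rule sorted_wrt_mono_rel[rotated])
          fix U V assume UV: "U \<in> set \<rho>\<^sub>2" "V \<in> set \<rho>\<^sub>2" "(V, U) \<notin> arcs J"
          have notin: "N \<notin> U" "N \<notin> V" using UV set2 N_notin by simp_all
          show "(insert N V, insert N U) \<notin> arcs I"
          proof
            assume "(insert N V, insert N U) \<in> arcs I"
            then obtain X x y where X: "insert N V = X - {x}" "insert N U = X - {y}"
              "x \<in> X" "y \<in> X" "if X \<in> I then x < y else y < x"
              by (elim arcsE)
            have "N \<in> X - {x}" "N \<in> X - {y}" using X(1,2) by blast+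
            then have N: "N \<in> X" "N \<noteq> x" "N \<noteq> y" by auto
            define Y where "Y = X - {N}"
            have V: "V = Y - {x}"
              using arg_cong[OF X(1), of "\<lambda>Z. Z - {N}"] notin(2) by (auto simp: Y_def)
            have U: "U = Y - {y}"
              using arg_cong[OF X(2), of "\<lambda>Z. Z - {N}"] notin(1) by (auto simp: Y_def)
            have xy: "x \<in> Y" "y \<in> Y" using X(3,4) N by (auto simp: Y_def)
            have "Y - {x} \<in> [{1..m}]\<^bsup>k'\<^esup>" using UV(2) set2(1) V by simp
            moreover have "Y - {y} \<subseteq> {1..m}" using UV(1) set2(1) U by (auto simp: nsets_def)
            moreover have "x \<noteq> y" using X(5) by (auto split: if_splits)
            moreover from calculation(1) have "finite Y" "card Y = k"
              using card_Suc_Diff1[of Y x] xy(1) by (simp_all add: nsets_def k)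
            ultimately have "Y \<in> [{1..m}]\<^bsup>k\<^esup>"
              by (auto simp: nsets_def)
            moreover have "X = insert N Y" using N(1) by (auto simp: Y_def)
            ultimately have "X \<in> I \<longleftrightarrow> Y \<in> J" by (simp add: J_def)
            then have "(V, U) \<in> arcs J" using X(5) xy unfolding U V by (simp add: arcs_iff)
            with UV(3) show False ..
          qed
        qed
        then show ?thesis by (simp add: sorted_wrt_map)
      qed
      have lower_upper: "(V, U) \<notin> arcs I"
        if U: "U \<in> [{1..m}]\<^bsup>k\<^esup>" "U \<notin> J" and V: "V \<in> [{1..m}]\<^bsup>k\<^esup>" "V \<in> J" for U V
      proof
        assume arc: "(V, U) \<in> arcs I"
        then obtain X x y where X: "V = X - {x}" "U = X - {y}" "x \<in> X" "y \<in> X"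
          and union: "X = V \<union> U" and xy: "if X \<in> I then x < y else y < x"
          by (elim arcsE)
        have Xm: "X \<in> [{1..m}]\<^bsup>Suc k\<^esup>"
          unfolding union using arcs_union_nsets(1)[OF arc V(1) U(1)] .
        \<comment> \<open>Read the packet of \<open>insert N X\<close> at \<open>x\<close>,
          \<open>y\<close> and the largest element \<open>N\<close>, where the value is membership
          of \<open>X\<close> in \<open>I\<close>. The direction of the arc makes this
          \<open>x < y < N\<close> with true, false, true, or \<open>y < x < N\<close> with false,
          true, false.\<close>
        have "insert N X - {x} \<in> I" "insert N X - {y} \<notin> I" "x < N" "y < N"
          using J_iff[OF Xm] X U(2) V(2) less_N[OF _ Xm] by simp_all
        moreover have "insert N X - {N} = X" using N_notin[OF Xm] by simp
        ultimately show False
          using closed_N[OF Xm] X(3,4) xy by (auto simp: between_closed_def split: if_splits)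
      qed
      \<comment> \<open>\<open>U\<close> arises from \<open>insert N U\<close> by removing the
        largest element, so it is the lex least member of that packet. It has to come first if
        \<open>U\<close> is not in \<open>J\<close>, and last if it is; the second case is
        \<open>new_upper\<close>.\<close>
      have lower_new: "(insert N V, U) \<notin> arcs I"
        if U: "U \<in> [{1..m}]\<^bsup>k\<^esup>" "U \<notin> J" and V: "V \<in> [{1..m}]\<^bsup>k'\<^esup>" for U V
      proof
        assume "(insert N V, U) \<in> arcs I"
        then obtain X x y where X: "insert N V = X - {x}" "U = X - {y}" "x \<in> X" "y \<in> X"
          "if X \<in> I then x < y else y < x"
          by (elim arcsE)
        have "N \<in> X - {x}" "N \<notin> X - {y}" using X(1,2) N_notin[OF U(1)] by blast+
        then have "y = N" by blast
        then have "X = insert N U" using X(2,4) by blast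
        then have "X \<notin> I" using U by (simp add: J_def)
        then have "N < x" using X(5) \<open>y = N\<close> by simp
        moreover have "x \<in> U" using \<open>N < x\<close> \<open>y = N\<close> X(2,3) by simp
        ultimately show False using less_N[OF _ U(1)] by fastforce
      qed
      have new_upper: "(V, insert N U) \<notin> arcs I"
        if U: "U \<in> [{1..m}]\<^bsup>k'\<^esup>" and V: "V \<in> [{1..m}]\<^bsup>k\<^esup>" "V \<in> J" for U V
      proof
        assume "(V, insert N U) \<in> arcs I"
        then obtain X x y where X: "V = X - {x}" "insert N U = X - {y}" "x \<in> X" "y \<in> X"
          "if X \<in> I then x < y else y < x"
          by (elim arcsE)
        have "N \<in> X - {y}" "N \<notin> X - {x}" using X(1,2) N_notin[OF V(1)] by blast+
        then have "x = N" by blast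
        then have "X = insert N V" using X(1,3) by blast
        then have "X \<in> I" using V by (simp add: J_def)
        then have "N < y" using X(5) \<open>x = N\<close> by simp
        moreover have "y \<in> V" using \<open>N < y\<close> \<open>x = N\<close> X(1,4) by simp
        ultimately show False using less_N[OF _ V(1)] by fastforce
      qed
      show ?thesis
        unfolding \<rho>_def sorted_wrt_append
        using old new lower_upper lower_new new_upper set1(1) set2(1)
        by (auto intro: sorted_wrt_filter)
    qed
    ultimately show ?thesis unfolding realizes_def N_def by blast
  qed
qed


subsection \<open>Cover relations\<close>

text \<open>Only arcs inside the packet of \<open>X\<close> can differ between \<open>I\<close> and
  \<open>insert X I\<close>. The block consists of exactly these sets, and its reversal is the
  antilex order that \<open>insert X I\<close> prescribes.\<close>

lemma realizes_block_reversal: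
  assumes "realizes n k I (us @ bs @ vs)" "set bs = packet X" "lex_sorted bs"
    and "X \<in> [{1..n}]\<^bsup>Suc k\<^esup>"
  shows "realizes n k (insert X I) (us @ rev bs @ vs)"
proof -
  have orders: "us @ bs @ vs \<in> total_orders n k"
    and sorted: "sorted_wrt (\<lambda>U V. (V, U) \<notin> arcs I) (us @ bs @ vs)"
    using assms(1) by (auto simp: realizes_def)
  have arcs: "(V, U) \<notin> arcs (insert X I)"
    if "(V, U) \<notin> arcs I" "\<not> (U \<in> packet X \<and> V \<in> packet X)"
      "U \<in> [{1..n}]\<^bsup>k\<^esup>" "V \<in> [{1..n}]\<^bsup>k\<^esup>" for U V
  proof
    assume arc: "(V, U) \<in> arcs (insert X I)"
    then have "V \<union> U \<noteq> X" using arcs_union_nsets(2,3)[OF arc that(4,3)] that(2) by metis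
    then have "V \<union> U \<in> insert X I \<longleftrightarrow> V \<union> U \<in> I" by simp
    with arc that(1) arcs_cong[of V U "insert X I" I] show False by simp
  qed
  have sets: "set us \<union> set bs \<union> set vs = [{1..n}]\<^bsup>k\<^esup>"
    "set us \<inter> set bs = {}" "set vs \<inter> set bs = {}" "distinct bs"
    using orders by (auto simp: total_orders_iff)
  have part: "sorted_wrt (\<lambda>U V. (V, U) \<notin> arcs (insert X I)) xs"
    if "sorted_wrt (\<lambda>U V. (V, U) \<notin> arcs I) xs" "set xs \<inter> set bs = {}" "set xs \<subseteq> [{1..n}]\<^bsup>k\<^esup>" for xs
    using that(1) by (rule sorted_wrt_mono_rel[rotated]) (use that assms(2) arcs in blast)
  have "sorted_wrt (\<lambda>U V. (U, V) \<notin> arcs (insert X I)) bs"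
  proof -
    have fin: "finite X" using assms(4) by (simp add: nsets_def)
    have "(U, V) \<notin> arcs (insert X I)"
      if "U \<in> set bs" "V \<in> set bs" "U \<noteq> V" "lex_less U V" for U V
      using that packet_arcs_iff[OF fin, of U V "insert X I"] packet_lex_total[OF fin, of U V]
        assms(2) by simp
    with sets(4) assms(3) show ?thesis
      unfolding lex_sorted_def by (elim sorted_wrt_mono_distinct)
  qed
  then have "sorted_wrt (\<lambda>U V. (V, U) \<notin> arcs (insert X I)) (rev bs)"
    by (simp add: sorted_wrt_rev)
  moreover have "sorted_wrt (\<lambda>U V. (V, U) \<notin> arcs (insert X I)) us"
    "sorted_wrt (\<lambda>U V. (V, U) \<notin> arcs (insert X I)) vs"
    using sorted sets by (auto simp: sorted_wrt_append intro!: part)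
  moreover have "(V, U) \<notin> arcs (insert X I)"
    if "U \<in> set us \<and> V \<in> set bs \<union> set vs \<or> U \<in> set bs \<and> V \<in> set vs" for U V
  proof (rule arcs)
    show "(V, U) \<notin> arcs I" using sorted that by (auto simp: sorted_wrt_append)
    show "\<not> (U \<in> packet X \<and> V \<in> packet X)" using sets that assms(2) by blast
  qed (use sets that in blast)+
  ultimately have "sorted_wrt (\<lambda>U V. (V, U) \<notin> arcs (insert X I)) (us @ rev bs @ vs)"
    by (simp add: sorted_wrt_append)
  moreover have "us @ rev bs @ vs \<in> total_orders n k"
    using orders by (auto simp: total_orders_iff)
  ultimately show ?thesis by (simp add: realizes_def)
qed


text \<open>In an arbitrary linear extension the packet of \<open>X\<close> may be scattered. One is
  rearranged into the sets forced to precede some packet member, the packet itself, and the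
  rest.\<close>

lemma realizes_packet_block:
  assumes "consistent n (Suc k) I" "consistent n (Suc k) (insert X I)" "X \<notin> I"
  obtains us bs vs where "realizes n k I (us @ bs @ vs)" "set bs = packet X" "lex_sorted bs"
proof -
  define S where "S = [{1..n}]\<^bsup>k\<^esup>"
  define Q where "Q = packet X"
  have X: "X \<in> [{1..n}]\<^bsup>Suc k\<^esup>" using assms(2) by (simp add: consistent_def)
  then have Q_S: "Q \<subseteq> S" unfolding Q_def S_def by (rule packet_subset_nsets)
  have fin: "finite X" using X by (simp add: nsets_def)
  have rank: "\<exists>f :: nat set \<Rightarrow> nat. \<forall>U \<in> S. \<forall>V \<in> S. (U, V) \<in> arcs K \<longrightarrow> U \<noteq> V \<longrightarrow> f U < f V"
    if "consistent n (Suc k) K" for K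
  proof -
    from consistent_imp_realizes[OF that] obtain \<tau> where "realizes n k K \<tau>" by blast
    then show ?thesis
      using sorted_wrt_rank[of "arcs K" \<tau>] by (simp add: realizes_def total_orders_iff S_def)
  qed
  have irrefl: "U \<noteq> V" if "(U, V) \<in> arcs K" for U V K
    using that by (elim arcsE) blast
  obtain f :: "nat set \<Rightarrow> nat" where f: "f U < f V" if "U \<in> S" "V \<in> S" "(U, V) \<in> arcs I" for U V
    using rank[OF assms(1)] irrefl by blast
  obtain g :: "nat set \<Rightarrow> nat"
    where g: "g U < g V" if "U \<in> S" "V \<in> S" "(U, V) \<in> arcs (insert X I)" for U V
    using rank[OF assms(2)] irrefl by blast
  \<comment> \<open>An arc not inside \<open>Q\<close> is an arc for both families, so both ranks
    increase along it.\<close>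
  have fg: "f U < f V \<and> g U < g V"
    if UV: "U \<in> S" "V \<in> S" and arc: "(U, V) \<in> arcs I" and "\<not> (U \<in> Q \<and> V \<in> Q)" for U V
  proof -
    have "U \<union> V \<noteq> X"
      using arcs_union_nsets(2,3)[OF arc] that unfolding S_def Q_def by metis
    then have "U \<union> V \<in> I \<longleftrightarrow> U \<union> V \<in> insert X I" by simp
    then have "(U, V) \<in> arcs (insert X I)" using arc arcs_cong[of U V I "insert X I"] by simp
    then show ?thesis using f g UV arc by blast
  qed
  \<comment> \<open>Arcs starting in \<open>Q\<close> are left out, so a path in \<open>T\<close>
    can meet \<open>Q\<close> only at its end, and both ranks increase along the whole path.\<close>
  define T where "T = {(U, V). (U, V) \<in> arcs I \<and> U \<in> S \<and> V \<in> S \<and> U \<notin> Q}"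
  have T_less: "f U < f V \<and> g U < g V \<and> U \<notin> Q" if "(U, V) \<in> T\<^sup>+" for U V
    using that
  proof (induction rule: trancl_induct)
    case (base V)
    then show ?case using fg by (auto simp: T_def)
  next
    case (step V W)
    then have "f V < f W \<and> g V < g W" using fg by (auto simp: T_def)
    with step.IH show ?case by linarith
  qed
  define D where "D = {Z. \<exists>q \<in> Q. (Z, q) \<in> T\<^sup>+}"
  have D_Q: "Z \<notin> Q" if "Z \<in> D" for Z
    using that T_less by (auto simp: D_def)
  have into_D: "U \<in> D" if "(U, V) \<in> arcs I" "U \<in> S" "V \<in> S" "U \<notin> Q" "V \<in> D \<union> Q" for U V
  proof -
    have "(U, V) \<in> T" using that by (simp add: T_def)
    then show ?thesis using that(5) unfolding D_def by (blast intro: trancl_into_trancl2)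
  qed
  text \<open>\<open>Q\<close> is convex: reversing \<open>Q\<close> turns a path that leaves \<open>Q\<close> and returns into a cycle, so the
    rank functions for \<open>I\<close> and \<open>insert X I\<close> cannot both increase along it.\<close>
  have convex: "(U, V) \<notin> arcs I" if "U \<in> Q" "V \<in> D" "V \<in> S" for U V
  proof
    assume "(U, V) \<in> arcs I"
    then have "f U < f V \<and> g U < g V" using fg that D_Q Q_S by blast
    moreover from that(2) T_less obtain W where W: "W \<in> Q" "f V < f W" "g V < g W"
      by (auto simp: D_def)
    ultimately have less: "f U < f W" "g U < g W" by auto
    then have "U \<noteq> W" by auto
    have "(W, U) \<notin> arcs I" "(W, U) \<notin> arcs (insert X I)"
      using f[of W U] g[of W U] less W(1) that(1) Q_S by auto
    moreover have "W \<in> packet X" "U \<in> packet X" using W(1) that(1) by (simp_all add: Q_def)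
    ultimately show False
      using \<open>U \<noteq> W\<close> packet_arcs_iff[OF fin, of W U] packet_lex_total[OF fin, of W U] assms(3)
      by auto
  qed
  obtain \<rho> where \<rho>: "realizes n k I \<rho>" using consistent_imp_realizes[OF assms(1)] by blast
  then have set_\<rho>: "set \<rho> = S" and dist: "distinct \<rho>" and orders: "\<rho> \<in> total_orders n k"
    and sorted: "sorted_wrt (\<lambda>U V. (V, U) \<notin> arcs I) \<rho>"
    by (auto simp: realizes_def total_orders_iff S_def)
  \<comment> \<open>Filtering keeps the order of \<open>\<rho>\<close> within each part. Arcs from
    the packet back to \<open>D\<close> are excluded by \<open>convex\<close>, and arcs from the
    rest into \<open>D\<close> or the packet by \<open>into_D\<close>.\<close>
  define us where "us = filter (\<lambda>Z. Z \<in> D) \<rho>"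
  define bs where "bs = filter (\<lambda>Z. Z \<in> Q) \<rho>"
  define vs where "vs = filter (\<lambda>Z. Z \<notin> D \<union> Q) \<rho>"
  have set_bs: "set bs = packet X"
    using Q_S set_\<rho> unfolding bs_def Q_def by auto
  have "lex_sorted bs"
    using sorted X assms(3) unfolding sorted_wrt_packets_iff[OF orders]
    by (auto simp: bs_def Q_def restrict_order_def split: if_splits)
  moreover have "us @ bs @ vs \<in> total_orders n k"
  proof -
    have "set (us @ bs @ vs) = S"
      using set_\<rho> by (auto simp: us_def bs_def vs_def)
    moreover have "distinct (us @ bs @ vs)"
      using dist D_Q by (auto simp: us_def bs_def vs_def)
    ultimately show ?thesis by (simp add: total_orders_iff S_def)
  qed
  moreover have "sorted_wrt (\<lambda>U V. (V, U) \<notin> arcs I) (us @ bs @ vs)"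
  proof -
    have "(V, U) \<notin> arcs I" if "U \<in> set us" "V \<in> set bs" for U V
      using that convex set_\<rho> by (auto simp: us_def bs_def)
    moreover have "(V, U) \<notin> arcs I" if "U \<in> set us \<union> set bs" "V \<in> set vs" for U V
      using that into_D[of V U] set_\<rho> by (auto simp: us_def bs_def vs_def)
    moreover have "sorted_wrt (\<lambda>U V. (V, U) \<notin> arcs I) xs" if "xs \<in> {us, bs, vs}" for xs
      using that sorted unfolding us_def bs_def vs_def by (auto intro: sorted_wrt_filter)
    ultimately show ?thesis unfolding sorted_wrt_append by auto
  qed
  ultimately show thesis using that set_bs by (simp add: realizes_def)
qed


subsection \<open>Isomorphisms of closures of cover relations\<close>

lemma rtrancl_image_iff:
  assumes bij: "bij_betw f A B" and sub: "r \<subseteq> A \<times> A" "s \<subseteq> B \<times> B"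
    and cover: "\<And>x y. x \<in> A \<Longrightarrow> y \<in> A \<Longrightarrow> (x, y) \<in> r \<longleftrightarrow> (f x, f y) \<in> s"
    and xy: "x \<in> A" "y \<in> A"
  shows "(x, y) \<in> r\<^sup>* \<longleftrightarrow> (f x, f y) \<in> s\<^sup>*"
proof
  assume "(x, y) \<in> r\<^sup>*"
  then show "(f x, f y) \<in> s\<^sup>*"
  proof (induction rule: rtrancl_induct)
    case (step y z)
    then have "(f y, f z) \<in> s" using cover sub(1) by blast
    with step.IH show ?case by simp
  qed simp
next
  have "\<exists>z \<in> A. v = f z \<and> (x, z) \<in> r\<^sup>*" if "(f x, v) \<in> s\<^sup>*" for v
    using that
  proof (induction rule: rtrancl_induct)
    case base
    then show ?case using xy(1) by blast
  next
    case (step v w)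
    then obtain z where z: "z \<in> A" "v = f z" "(x, z) \<in> r\<^sup>*" by blast
    moreover obtain z' where z': "z' \<in> A" "w = f z'"
      using step.hyps(2) sub(2) bij_betw_imp_surj_on[OF bij] by blast
    ultimately have "(z, z') \<in> r" using step.hyps(2) cover by simp
    with z z' show ?case by (blast intro: rtrancl_into_rtrancl)
  qed
  moreover assume "(f x, f y) \<in> s\<^sup>*"
  ultimately obtain z where "z \<in> A" "f y = f z" "(x, z) \<in> r\<^sup>*" by blast
  then show "(x, y) \<in> r\<^sup>*"
    using bij_betw_imp_inj_on[OF bij] xy(2) by (simp add: inj_on_eq_iff)
qed

text \<open>Antisymmetry is asked for on one side only, because the bijection carries it over. For
  the orders on classes it is obtained in this way.\<close>

lemma poset_iso_closure_on:
  assumes bij: "bij_betw f A B" and sub: "r \<subseteq> A \<times> A" "s \<subseteq> B \<times> B"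
    and cover: "\<And>x y. x \<in> A \<Longrightarrow> y \<in> A \<Longrightarrow> (x, y) \<in> r \<longleftrightarrow> (f x, f y) \<in> s"
    and anti: "antisym (closure_on A r) \<or> antisym (closure_on B s)"
  shows "poset_iso A (closure_on A r) B (closure_on B s) f"
proof -
  have iff: "(x, y) \<in> closure_on A r \<longleftrightarrow> (f x, f y) \<in> closure_on B s" if "x \<in> A" "y \<in> A" for x y
    using rtrancl_image_iff[OF bij sub cover that] that bij_betwE[OF bij]
    by (auto simp: closure_on_def)
  have inj: "x = y" if "f x = f y" "x \<in> A" "y \<in> A" for x y
    using that bij_betw_imp_inj_on[OF bij] by (simp add: inj_on_eq_iff)
  have antisym: "antisym (closure_on A r) \<and> antisym (closure_on B s)"
    using anti
  proof
    assume A: "antisym (closure_on A r)"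
    have "u = v" if uv: "(u, v) \<in> closure_on B s" "(v, u) \<in> closure_on B s" for u v
    proof -
      obtain x y where xy: "x \<in> A" "u = f x" "y \<in> A" "v = f y"
        using uv(1) bij_betw_imp_surj_on[OF bij] by (auto simp: closure_on_def)
      then have "(x, y) \<in> closure_on A r" "(y, x) \<in> closure_on A r"
        using uv iff by simp_all
      with A have "x = y" by (rule antisymD)
      with xy show ?thesis by simp
    qed
    with A show ?thesis by (auto intro: antisymI)
  next
    assume B: "antisym (closure_on B s)"
    have "x = y" if xy: "(x, y) \<in> closure_on A r" "(y, x) \<in> closure_on A r" for x y
    proof -
      have "x \<in> A" "y \<in> A" using xy(1) by (auto simp: closure_on_def)
      moreover from this have "f x = f y" using antisymD[OF B] xy iff by simp
      ultimately show ?thesis using inj by simp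
    qed
    with B show ?thesis by (auto intro: antisymI)
  qed
  have "partial_order_on A (closure_on A r)" "partial_order_on B (closure_on B s)"
    using antisym by (auto simp: partial_order_on_def preorder_on_def closure_on_def refl_on_def
        intro: transI)
  with bij iff show ?thesis by (simp add: poset_iso_def)
qed

lemma poset_iso_comp:
  assumes "poset_iso A r B s f" "poset_iso B s C t g"
  shows "poset_iso A r C t (g \<circ> f)"
  using assms bij_betw_trans[of f A B g C] bij_betwE[of f A B]
  by (auto simp: poset_iso_def)

text \<open>On \<open>B\<close> the map \<open>h\<close> is \<open>f\<close> after the inverse of
  \<open>g\<close>. This yields the last side of a commuting square from the other three.\<close>

lemma poset_iso_cancel:
  assumes g: "poset_iso A r B s g" and f: "poset_iso A r C t f"
    and comm: "\<And>x. x \<in> A \<Longrightarrow> h (g x) = f x"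
  shows "poset_iso B s C t h"
proof -
  have bij: "bij_betw g A B" using g by (simp add: poset_iso_def)
  have "bij_betw (h \<circ> g) A C"
    using f comm by (auto simp: poset_iso_def cong: bij_betw_cong)
  then have "bij_betw h B C" using bij_betw_comp_iff[OF bij] by blast
  moreover have "(u, v) \<in> s \<longleftrightarrow> (h u, h v) \<in> t" if "u \<in> B" "v \<in> B" for u v
  proof -
    from that obtain x y where "x \<in> A" "u = g x" "y \<in> A" "v = g y"
      using bij_betw_imp_surj_on[OF bij] by blast
    then show ?thesis using f g comm by (simp add: poset_iso_def)
  qed
  ultimately show ?thesis using f g by (simp add: poset_iso_def)
qed

lemma antisym_closure_on_single_step: "antisym (closure_on S (single_step S))"
proof -
  have "I \<subseteq> J" if "(I, J) \<in> (single_step S)\<^sup>*" for I J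
    using that by (induction rule: rtrancl_induct) (auto simp: single_step_def)
  then show ?thesis by (auto simp: closure_on_def intro!: antisymI)
qed

lemma single_step_subset: "single_step S \<subseteq> S \<times> S"
  by (auto simp: single_step_def)

lemma Bruhat_cover_subset: "Bruhat_cover n k \<subseteq> Bruhat n k \<times> Bruhat n k"
  by (auto simp: Bruhat_cover_def)

lemma coBruhat_cover_subset: "coBruhat_cover n k \<subseteq> coBruhat n k \<times> coBruhat n k"
  by (auto simp: coBruhat_cover_def)


subsection \<open>Higher Bruhat orders and consistent sets\<close>

lemma Rev_ord_consistent:
  assumes "1 \<le> k" "admissible n k \<rho>"
  shows "consistent n (Suc k) (Rev_ord n k \<rho>)"
  using realizes_Rev_ord[OF assms] by (rule consistent_if_realizes) (auto simp: Rev_ord_def)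

lemma realizes_admissible:
  assumes "1 \<le> k" "consistent n (Suc k) I" "realizes n k I \<rho>"
  shows "admissible n k \<rho>" "Rev_ord n k \<rho> = I"
  using assms realizes_iff[of k I n \<rho>] by (auto simp: consistent_def)

text \<open>Orders realizing the same set are equivalent, so membership in a class can be tested
  through \<open>Rev\<close>. Covers can then be witnessed by representatives built for the
  purpose.\<close>

lemma realizes_mem_Bruhat:
  assumes "1 \<le> k" "C \<in> Bruhat n k" "realizes n k (Rev n k C) \<rho>"
  shows "\<rho> \<in> C"
proof -
  obtain \<rho>' where \<rho>': "C = comm_class \<rho>'" "admissible n k \<rho>'"
    using assms(2) by (auto simp: Bruhat_eq)
  then have "realizes n k (Rev n k C) \<rho>'"
    using realizes_Rev_ord[OF assms(1) \<rho>'(2)] by (simp add: Rev_comm_class)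
  then show ?thesis using realizes_comm_eq assms(3) \<rho>'(1) by (simp add: mem_comm_class)
qed

lemma bij_betw_Rev:
  assumes "1 \<le> k"
  shows "bij_betw (Rev n k) (Bruhat n k) (Cons_sets n (Suc k))"
  unfolding bij_betw_def
proof
  show "inj_on (Rev n k) (Bruhat n k)"
  proof (rule inj_onI)
    fix C D assume CD: "C \<in> Bruhat n k" "D \<in> Bruhat n k" "Rev n k C = Rev n k D"
    then obtain \<rho> where \<rho>: "C = comm_class \<rho>" "admissible n k \<rho>" by (auto simp: Bruhat_eq)
    then have "realizes n k (Rev n k D) \<rho>"
      using realizes_Rev_ord[OF assms \<rho>(2)] CD(3) by (simp add: Rev_comm_class)
    then have "\<rho> \<in> D" using realizes_mem_Bruhat[OF assms CD(2)] by blast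
    then show "C = D" using Bruhat_mem(2)[OF CD(2)] \<rho>(1) by simp
  qed
  show "Rev n k ` Bruhat n k = Cons_sets n (Suc k)"
  proof (intro equalityI subsetI)
    fix I assume "I \<in> Rev n k ` Bruhat n k"
    then show "I \<in> Cons_sets n (Suc k)"
      using assms by (auto simp: Bruhat_eq Rev_comm_class Cons_sets_def Rev_ord_consistent)
  next
    fix I assume "I \<in> Cons_sets n (Suc k)"
    then have I: "consistent n (Suc k) I" by (simp add: Cons_sets_def)
    then obtain \<rho> where "realizes n k I \<rho>" using consistent_imp_realizes by blast
    note \<rho> = realizes_admissible[OF assms I this]
    then have "I = Rev n k (comm_class \<rho>)" by (simp add: Rev_comm_class)
    then show "I \<in> Rev n k ` Bruhat n k" using \<rho>(1) unfolding Bruhat_eq by blast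
  qed
qed

lemma Rev_cover_iff:
  assumes k: "1 \<le> k" and CD: "C \<in> Bruhat n k" "D \<in> Bruhat n k"
  shows "(C, D) \<in> Bruhat_cover n k \<longleftrightarrow> (Rev n k C, Rev n k D) \<in> single_step (Cons_sets n (Suc k))"
proof
  assume "(C, D) \<in> Bruhat_cover n k"
  then obtain us bs vs X where mem: "us @ bs @ vs \<in> C" "us @ rev bs @ vs \<in> D"
    and X: "X \<in> [{1..n}]\<^bsup>Suc k\<^esup>" "set bs = packet X" "lex_sorted bs"
    by (auto simp: Bruhat_cover_def block_reversal_def)
  define \<rho> where "\<rho> = us @ bs @ vs"
  define \<sigma> where "\<sigma> = us @ rev bs @ vs"
  have \<rho>: "admissible n k \<rho>" "Rev n k C = Rev_ord n k \<rho>"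
    using Bruhat_mem[OF CD(1) mem(1)] Rev_comm_class by (auto simp: \<rho>_def)
  have \<sigma>: "Rev n k D = Rev_ord n k \<sigma>"
    using Bruhat_mem[OF CD(2) mem(2)] Rev_comm_class by (auto simp: \<sigma>_def)
  have orders: "\<rho> \<in> total_orders n k" using \<rho>(1) by (simp add: admissible_def)
  have "realizes n k (insert X (Rev_ord n k \<rho>)) \<sigma>"
    using realizes_Rev_ord[OF k \<rho>(1)] X unfolding \<rho>_def \<sigma>_def
    by (intro realizes_block_reversal)
  then have "Rev_ord n k \<sigma> = insert X (Rev_ord n k \<rho>)"
    using realizes_iff[of k "insert X (Rev_ord n k \<rho>)" n \<sigma>] k X(1) by (auto simp: Rev_ord_def)
  \<comment> \<open>A single step must add a new element. The restriction of \<open>\<rho>\<close>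
    to the packet is the block itself, which is lex sorted and hence not antilex sorted.\<close>
  moreover have "X \<notin> Rev_ord n k \<rho>"
  proof -
    have "restrict_order \<rho> (packet X) = bs"
    proof -
      have "filter (\<lambda>Y. Y \<in> packet X) us = []" "filter (\<lambda>Y. Y \<in> packet X) vs = []"
        using orders unfolding X(2)[symmetric] filter_empty_conv \<rho>_def total_orders_iff by auto
      then show ?thesis using X(2) by (simp add: restrict_order_def \<rho>_def filter_id_conv)
    qed
    then have "\<not> antilex_sorted (restrict_order \<rho> (packet X))"
      using restrict_lex_iff_not_antilex[OF X(1) k orders] X(3) by simp
    then show ?thesis by (simp add: Rev_ord_def)
  qed
  moreover have "Rev n k C \<in> Cons_sets n (Suc k)" "Rev n k D \<in> Cons_sets n (Suc k)"
    using bij_betwE[OF bij_betw_Rev[OF k]] CD by auto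
  ultimately show "(Rev n k C, Rev n k D) \<in> single_step (Cons_sets n (Suc k))"
    using \<rho>(2) \<sigma> by (auto simp: single_step_def)
next
  assume "(Rev n k C, Rev n k D) \<in> single_step (Cons_sets n (Suc k))"
  then obtain X where X: "X \<notin> Rev n k C" "Rev n k D = insert X (Rev n k C)"
    and cons: "consistent n (Suc k) (Rev n k C)" "consistent n (Suc k) (insert X (Rev n k C))"
    by (auto simp: single_step_def Cons_sets_def)
  obtain us bs vs where block: "realizes n k (Rev n k C) (us @ bs @ vs)"
    "set bs = packet X" "lex_sorted bs"
    using realizes_packet_block[OF cons X(1)] .
  have X_nsets: "X \<in> [{1..n}]\<^bsup>Suc k\<^esup>" using cons(2) by (simp add: consistent_def)
  have "realizes n k (Rev n k D) (us @ rev bs @ vs)"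
    unfolding X(2) using block X_nsets by (rule realizes_block_reversal)
  then have "us @ bs @ vs \<in> C" "us @ rev bs @ vs \<in> D"
    using realizes_mem_Bruhat[OF k] CD block(1) by blast+
  moreover have "(us @ bs @ vs, us @ rev bs @ vs) \<in> block_reversal (packet X)"
    using block(2,3) unfolding block_reversal_def by blast
  ultimately show "(C, D) \<in> Bruhat_cover n k"
    using CD X_nsets unfolding Bruhat_cover_def by blast
qed

lemma poset_iso_Rev:
  assumes "1 \<le> k"
  shows "poset_iso (Bruhat n k) (Bruhat_le n k) (Cons_sets n (k + 1)) (Cons_le n (k + 1)) (Rev n k)"
  unfolding Bruhat_le_def Cons_le_def Suc_eq_plus1[symmetric]
  using bij_betw_Rev[OF assms] Bruhat_cover_subset single_step_subset Rev_cover_iff[OF assms]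
    disjI2[OF antisym_closure_on_single_step]
  by (rule poset_iso_closure_on)


subsection \<open>Complementation\<close>

lemma compl_nsets:
  assumes "k \<le> n"
  shows "(\<lambda>X. {1..n} - X) ` [{1..n}]\<^bsup>k\<^esup> = [{1..n}]\<^bsup>(n - k)\<^esup>"
proof (intro equalityI subsetI)
  fix Y assume "Y \<in> (\<lambda>X. {1..n} - X) ` [{1..n}]\<^bsup>k\<^esup>"
  then show "Y \<in> [{1..n}]\<^bsup>(n - k)\<^esup>" by (auto simp: nsets_def card_Diff_subset)
next
  fix Y assume Y: "Y \<in> [{1..n}]\<^bsup>(n - k)\<^esup>"
  then have "{1..n} - Y \<in> [{1..n}]\<^bsup>k\<^esup>" "{1..n} - ({1..n} - Y) = Y"
    using assms by (auto simp: nsets_def card_Diff_subset)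
  then show "Y \<in> (\<lambda>X. {1..n} - X) ` [{1..n}]\<^bsup>k\<^esup>" by (metis imageI)
qed

lemma nsets_pred_eq:
  assumes "k \<le> n"
  shows "nsets_pred n (n - k) = (\<lambda>X. {1..n} - X) ` [{1..n}]\<^bsup>Suc k\<^esup>"
proof (cases "k = n")
  case True
  \<comment> \<open>Both sides are empty here. The case is separate because for \<open>k = n\<close>
    the truncated \<open>n - Suc k\<close> is \<open>0\<close>, and there is one
    \<open>0\<close>-set.\<close>
  have "[{1..n}]\<^bsup>Suc n\<^esup> = {}" by (rule nsets_eq_empty) auto
  then show ?thesis using True by (simp add: nsets_pred_def)
next
  case False
  then have "nsets_pred n (n - k) = [{1..n}]\<^bsup>(n - Suc k)\<^esup>"
    using assms by (auto simp: nsets_pred_def nsets_def intro: finite_subset[OF _ finite_atLeastAtMost])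
  then show ?thesis using False assms compl_nsets[of "Suc k" n] by simp
qed

lemma compl_packet:
  assumes "X \<subseteq> {1..n}"
  shows "(\<lambda>Y. {1..n} - Y) ` packet X = copacket n ({1..n} - X)"
proof -
  have "{1..n} - (X - {x}) = insert x ({1..n} - X)" if "x \<in> X" for x
    using that assms by blast
  moreover have "{1..n} - ({1..n} - X) = X" using assms by blast
  ultimately show ?thesis unfolding packet_def copacket_def image_image by simp
qed

lemma compl_copacket:
  assumes "X \<subseteq> {1..n}"
  shows "(\<lambda>Y. {1..n} - Y) ` copacket n ({1..n} - X) = packet X"
proof -
  have "{1..n} - ({1..n} - Y) = Y" if "Y \<in> packet X" for Y
    using that assms by (auto simp: packet_def)
  then show ?thesis unfolding compl_packet[OF assms, symmetric] image_image by simp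
qed

text \<open>Removing \<open>x\<close> from \<open>X\<close> corresponds to inserting
  \<open>x\<close> into the complement. A larger \<open>x\<close> makes the first set lex smaller
  and the second lex larger.\<close>

lemma lex_less_compl:
  assumes "X \<subseteq> {1..n}" "U \<in> packet X" "V \<in> packet X"
  shows "lex_less ({1..n} - U) ({1..n} - V) \<longleftrightarrow> lex_less V U"
proof -
  from assms obtain x y where UV: "x \<in> X" "U = X - {x}" "y \<in> X" "V = X - {y}"
    by (auto simp: packet_def)
  then have eq: "{1..n} - U = insert x ({1..n} - X)" "{1..n} - V = insert y ({1..n} - X)"
    using assms(1) by blast+
  have "lex_less ({1..n} - U) ({1..n} - V) \<longleftrightarrow> x < y"
    unfolding eq using UV by (intro lex_less_insert) auto
  also have "\<dots> \<longleftrightarrow> lex_less V U"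
    using UV lex_less_remove[of X y x] finite_subset[OF assms(1)] by simp
  finally show ?thesis .
qed

section \<open>Complementation of orders and of commutation classes\<close>

lemma sorted_wrt_beta_ord:
  assumes "\<And>U V. U \<in> set bs \<Longrightarrow> V \<in> set bs \<Longrightarrow> lex_less ({1..n} - U) ({1..n} - V) \<longleftrightarrow> lex_less V U"
  shows "lex_sorted (beta_ord n bs) \<longleftrightarrow> lex_sorted bs"
    "antilex_sorted (beta_ord n bs) \<longleftrightarrow> antilex_sorted bs"
  unfolding lex_sorted_def antilex_sorted_def beta_ord_def sorted_wrt_rev sorted_wrt_map
  using assms by (auto elim!: sorted_wrt_mono_rel[rotated])

lemma beta_ord_invol:
  assumes "set \<rho> \<subseteq> Pow {1..n}"
  shows "beta_ord n (beta_ord n \<rho>) = \<rho>"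
proof -
  have "{1..n} - ({1..n} - X) = X" if "X \<in> set \<rho>" for X using that assms by blast
  then have "map (\<lambda>X. {1..n} - ({1..n} - X)) \<rho> = \<rho>" by (rule map_idI)
  then show ?thesis by (simp add: beta_ord_def rev_map o_def)
qed

lemma set_beta_ord: "set (beta_ord n \<rho>) = (\<lambda>X. {1..n} - X) ` set \<rho>"
  by (simp add: beta_ord_def)

lemma set_beta_ord_subset: "set (beta_ord n \<rho>) \<subseteq> Pow {1..n}"
  by (auto simp: set_beta_ord)

lemma total_orders_subset: "\<rho> \<in> total_orders n k \<Longrightarrow> set \<rho> \<subseteq> Pow {1..n}"
  by (auto simp: total_orders_iff nsets_def)

lemma inj_on_compl: "inj_on (\<lambda>X. N - X) (Pow N)"
  by (rule inj_onI) (metis PowD double_diff order_refl)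

lemma beta_ord_total_orders:
  assumes "k \<le> n" "\<rho> \<in> total_orders n k"
  shows "beta_ord n \<rho> \<in> total_orders n (n - k)"
proof -
  have "distinct (beta_ord n \<rho>)"
    using assms(2) inj_on_subset[OF inj_on_compl total_orders_subset[OF assms(2)]]
    by (simp add: beta_ord_def distinct_map total_orders_iff)
  then show ?thesis
    using assms compl_nsets[OF assms(1)] by (simp add: total_orders_iff set_beta_ord)
qed

lemma restrict_beta_ord:
  assumes "set \<rho> \<subseteq> Pow {1..n}" "X \<subseteq> {1..n}"
  shows "restrict_order (beta_ord n \<rho>) (copacket n ({1..n} - X)) =
    beta_ord n (restrict_order \<rho> (packet X))"
proof -
  have packet: "packet X \<subseteq> Pow {1..n}" using assms(2) by (auto simp: packet_def)
  have "{1..n} - Y \<in> copacket n ({1..n} - X) \<longleftrightarrow> Y \<in> packet X" if "Y \<in> set \<rho>" for Y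
    unfolding compl_packet[OF assms(2), symmetric]
    by (rule inj_on_image_mem_iff[OF inj_on_compl _ packet]) (use that assms(1) in auto)
  then have "filter (\<lambda>Y. {1..n} - Y \<in> copacket n ({1..n} - X)) \<rho> = filter (\<lambda>Y. Y \<in> packet X) \<rho>"
    by (rule filter_cong[OF refl])
  then show ?thesis
    by (simp add: restrict_order_def beta_ord_def filter_map rev_filter[symmetric] o_def)
qed

lemma restrict_beta_ord_sorted:
  assumes "\<rho> \<in> total_orders n k" "X \<in> [{1..n}]\<^bsup>l\<^esup>"
  shows "lex_sorted (restrict_order (beta_ord n \<rho>) (copacket n ({1..n} - X))) \<longleftrightarrow>
      lex_sorted (restrict_order \<rho> (packet X))"
    "antilex_sorted (restrict_order (beta_ord n \<rho>) (copacket n ({1..n} - X))) \<longleftrightarrow>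
      antilex_sorted (restrict_order \<rho> (packet X))"
proof -
  have X: "X \<subseteq> {1..n}" using assms(2) by (simp add: nsets_def)
  have lex: "lex_less ({1..n} - U) ({1..n} - V) \<longleftrightarrow> lex_less V U"
    if "U \<in> set (restrict_order \<rho> (packet X))" "V \<in> set (restrict_order \<rho> (packet X))" for U V
    using that lex_less_compl[OF X] by (simp add: restrict_order_def)
  show "lex_sorted (restrict_order (beta_ord n \<rho>) (copacket n ({1..n} - X))) \<longleftrightarrow>
      lex_sorted (restrict_order \<rho> (packet X))"
    "antilex_sorted (restrict_order (beta_ord n \<rho>) (copacket n ({1..n} - X))) \<longleftrightarrow>
      antilex_sorted (restrict_order \<rho> (packet X))"
    unfolding restrict_beta_ord[OF total_orders_subset[OF assms(1)] X]
    by (rule sorted_wrt_beta_ord(1), erule (1) lex) (rule sorted_wrt_beta_ord(2), erule (1) lex)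
qed

lemma coadmissible_beta_ord:
  assumes "k \<le> n" "\<rho> \<in> total_orders n k"
  shows "coadmissible n (n - k) (beta_ord n \<rho>) \<longleftrightarrow> admissible n k \<rho>"
  using assms restrict_beta_ord_sorted[OF assms(2)] beta_ord_total_orders[OF assms]
  by (simp add: coadmissible_def admissible_def nsets_pred_eq)

lemma Corev_ord_beta_ord:
  assumes "k \<le> n" "\<rho> \<in> total_orders n k"
  shows "Corev_ord n (n - k) (beta_ord n \<rho>) = gamma n (Rev_ord n k \<rho>)"
  using assms(1) restrict_beta_ord_sorted(2)[OF assms(2)]
  unfolding Corev_ord_def Rev_ord_def gamma_def nsets_pred_eq[OF assms(1)] by blast

lemma coadmissible_imp_beta_ord:
  assumes "k \<le> n" "coadmissible n (n - k) \<sigma>"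
  shows "admissible n k (beta_ord n \<sigma>)" "beta_ord n (beta_ord n \<sigma>) = \<sigma>"
proof -
  have \<sigma>: "\<sigma> \<in> total_orders n (n - k)" using assms(2) by (simp add: coadmissible_def)
  then show invol: "beta_ord n (beta_ord n \<sigma>) = \<sigma>"
    by (intro beta_ord_invol total_orders_subset)
  have "beta_ord n \<sigma> \<in> total_orders n k"
    using beta_ord_total_orders[OF _ \<sigma>] assms(1) by simp
  then show "admissible n k (beta_ord n \<sigma>)"
    using coadmissible_beta_ord[OF assms(1)] assms(2) invol by metis
qed

text \<open>If the packets of the complements meet, then \<open>X\<close> and \<open>Y\<close> have
  a common extension by one element, and distinct members of its packet do not commute. Distinctness
  matters: the empty set commutes with itself, but its complement \<open>N\<close>, if nonempty,
  does not.\<close>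

lemma commute_compl:
  assumes "commute X Y" "X \<noteq> Y" "X \<subseteq> N" "Y \<subseteq> N"
  shows "commute (N - X) (N - Y)"
proof (rule ccontr)
  assume "\<not> ?thesis"
  then obtain a b where ab: "a \<in> N - X" "b \<in> N - Y" "N - X - {a} = N - Y - {b}"
    by (auto simp: commute_def packet_def)
  have "N - (N - X - {a}) = insert a X" "N - (N - Y - {b}) = insert b Y"
    using ab(1,2) assms(3,4) by auto
  then have "insert a X = insert b Y" using ab(3) by simp
  moreover have "W \<in> packet (insert c W)" if "c \<notin> W" for c and W :: "nat set"
    unfolding packet_def using that by (intro image_eqI[of _ _ c]) auto
  ultimately have "X \<in> packet (insert a X)" "Y \<in> packet (insert a X)"
    using ab(1,2) by (metis DiffD2)+
  then show False using packet_not_commute assms(1,2) by blast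
qed

lemma comm_eq_beta_ord:
  assumes "(\<rho>, \<sigma>) \<in> comm_eq" "set \<rho> \<subseteq> Pow {1..n}"
  shows "(beta_ord n \<rho>, beta_ord n \<sigma>) \<in> comm_eq"
proof -
  have "(beta_ord n \<rho>, beta_ord n \<sigma>) \<in> comm_step\<^sup>* \<and> set \<sigma> \<subseteq> Pow {1..n}"
    using assms(1) unfolding comm_eq_def
  proof (induction rule: rtrancl_induct)
    case (step \<sigma> \<tau>)
    then obtain us vs X Y where XY: "commute X Y"
      and \<sigma>: "\<sigma> = us @ [X, Y] @ vs" and \<tau>: "\<tau> = us @ [Y, X] @ vs"
      unfolding comm_step_def by blast
    show ?case
    proof (cases "X = Y")
      case True
      then show ?thesis using step.IH \<sigma> \<tau> by simp
    next
      case False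
      have "commute ({1..n} - Y) ({1..n} - X)"
        using XY False step.IH by (intro commute_sym[OF commute_compl]) (auto simp: \<sigma>)
      moreover have "beta_ord n \<sigma> = beta_ord n vs @ [{1..n} - Y, {1..n} - X] @ beta_ord n us"
        "beta_ord n \<tau> = beta_ord n vs @ [{1..n} - X, {1..n} - Y] @ beta_ord n us"
        by (simp_all add: \<sigma> \<tau> beta_ord_def)
      ultimately have "(beta_ord n \<sigma>, beta_ord n \<tau>) \<in> comm_step"
        unfolding comm_step_def by blast
      then show ?thesis using step.IH by (auto simp: \<sigma> \<tau>)
    qed
  qed (use assms(2) in simp)
  then show ?thesis by (simp add: comm_eq_def)
qed

lemma comm_eq_beta_ord_iff:
  assumes "set \<rho> \<subseteq> Pow {1..n}" "set \<sigma> \<subseteq> Pow {1..n}"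
  shows "(beta_ord n \<rho>, beta_ord n \<sigma>) \<in> comm_eq \<longleftrightarrow> (\<rho>, \<sigma>) \<in> comm_eq"
  using comm_eq_beta_ord[of \<rho> \<sigma> n] comm_eq_beta_ord[of "beta_ord n \<rho>" "beta_ord n \<sigma>" n]
    beta_ord_invol assms set_beta_ord_subset by metis

lemma admissible_subset: "admissible n k \<rho> \<Longrightarrow> set \<rho> \<subseteq> Pow {1..n}"
  unfolding admissible_def by (rule total_orders_subset) blast

lemma coadmissible_subset: "coadmissible n k \<rho> \<Longrightarrow> set \<rho> \<subseteq> Pow {1..n}"
  unfolding coadmissible_def by (rule total_orders_subset) blast

lemma beta_comm_class:
  assumes "admissible n k \<rho>"
  shows "beta n (comm_class \<rho>) = comm_class (beta_ord n \<rho>)"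
proof -
  have "comm_class (beta_ord n \<sigma>) = comm_class (beta_ord n \<rho>)" if "(\<rho>, \<sigma>) \<in> comm_eq" for \<sigma>
    using comm_eq_beta_ord[OF that admissible_subset[OF assms]] by (metis comm_class_eq_iff)
  then show ?thesis unfolding beta_def by (rule the_elem_image_comm_class)
qed

lemma block_reversal_beta_ord:
  assumes "(\<rho>, \<sigma>) \<in> block_reversal Q"
    and "\<And>U V. U \<in> Q \<Longrightarrow> V \<in> Q \<Longrightarrow> lex_less ({1..n} - U) ({1..n} - V) \<longleftrightarrow> lex_less V U"
  shows "(beta_ord n \<rho>, beta_ord n \<sigma>) \<in> block_reversal ((\<lambda>X. {1..n} - X) ` Q)"
proof -
  from assms(1) obtain us bs vs where eq: "\<rho> = us @ bs @ vs" "\<sigma> = us @ rev bs @ vs"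
    and bs: "set bs = Q" "lex_sorted bs"
    unfolding block_reversal_def by blast
  have "beta_ord n \<rho> = beta_ord n vs @ beta_ord n bs @ beta_ord n us"
    "beta_ord n \<sigma> = beta_ord n vs @ rev (beta_ord n bs) @ beta_ord n us"
    by (simp_all add: eq beta_ord_def rev_map)
  moreover have "lex_sorted (beta_ord n bs)"
    using bs assms(2) by (subst sorted_wrt_beta_ord) auto
  moreover have "set (beta_ord n bs) = (\<lambda>X. {1..n} - X) ` Q"
    by (simp add: set_beta_ord bs(1))
  ultimately show ?thesis unfolding block_reversal_def by blast
qed

lemma bij_betw_beta:
  assumes "k \<le> n"
  shows "bij_betw (beta n) (Bruhat n k) (coBruhat n (n - k))"
  unfolding bij_betw_def
proof
  show "inj_on (beta n) (Bruhat n k)"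
  proof (rule inj_onI)
    fix C D assume "C \<in> Bruhat n k" "D \<in> Bruhat n k" and eq: "beta n C = beta n D"
    then obtain \<rho> \<sigma> where CD: "C = comm_class \<rho>" "D = comm_class \<sigma>"
      and adm: "admissible n k \<rho>" "admissible n k \<sigma>" by (auto simp: Bruhat_eq)
    then show "C = D"
      using eq comm_eq_beta_ord_iff[OF adm[THEN admissible_subset]] unfolding CD
      by (simp add: beta_comm_class comm_class_eq_iff)
  qed
  show "beta n ` Bruhat n k = coBruhat n (n - k)"
  proof (intro equalityI subsetI)
    fix C assume "C \<in> beta n ` Bruhat n k"
    then obtain \<rho> where \<rho>: "admissible n k \<rho>" "C = comm_class (beta_ord n \<rho>)"
      by (auto simp: Bruhat_eq beta_comm_class)
    then have "coadmissible n (n - k) (beta_ord n \<rho>)"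
      using coadmissible_beta_ord[OF assms] by (simp add: admissible_def)
    then show "C \<in> coBruhat n (n - k)" using \<rho>(2) by (simp add: coBruhat_eq)
  next
    fix C assume "C \<in> coBruhat n (n - k)"
    then obtain \<sigma> where \<sigma>: "C = comm_class \<sigma>" "coadmissible n (n - k) \<sigma>"
      by (auto simp: coBruhat_eq)
    note inv = coadmissible_imp_beta_ord[OF assms \<sigma>(2)]
    have "C = beta n (comm_class (beta_ord n \<sigma>))"
      using inv \<sigma>(1) by (simp add: beta_comm_class)
    then show "C \<in> beta n ` Bruhat n k" using inv(1) by (auto simp: Bruhat_eq)
  qed
qed

lemma beta_ord_mem_beta_iff:
  assumes "C \<in> Bruhat n k" "set \<rho> \<subseteq> Pow {1..n}"
  shows "beta_ord n \<rho> \<in> beta n C \<longleftrightarrow> \<rho> \<in> C"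
proof -
  obtain \<rho>' where \<rho>': "C = comm_class \<rho>'" "admissible n k \<rho>'"
    using assms(1) by (auto simp: Bruhat_eq)
  then show ?thesis
    using comm_eq_beta_ord_iff[OF admissible_subset[OF \<rho>'(2)] assms(2)] by (simp add: beta_comm_class mem_comm_class)
qed

lemma beta_cover_iff:
  assumes k: "k \<le> n" and CD: "C \<in> Bruhat n k" "D \<in> Bruhat n k"
  shows "(C, D) \<in> Bruhat_cover n k \<longleftrightarrow> (beta n C, beta n D) \<in> coBruhat_cover n (n - k)"
proof
  assume "(C, D) \<in> Bruhat_cover n k"
  then obtain \<rho> \<sigma> X where mem: "\<rho> \<in> C" "\<sigma> \<in> D" and X: "X \<in> [{1..n}]\<^bsup>Suc k\<^esup>"
    and rev: "(\<rho>, \<sigma>) \<in> block_reversal (packet X)"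
    by (auto simp: Bruhat_cover_def)
  have sub: "X \<subseteq> {1..n}" using X by (simp add: nsets_def)
  have "beta_ord n \<rho> \<in> beta n C" "beta_ord n \<sigma> \<in> beta n D"
    using mem beta_ord_mem_beta_iff admissible_subset[OF Bruhat_mem(1)] CD by blast+
  moreover have "(beta_ord n \<rho>, beta_ord n \<sigma>) \<in> block_reversal (copacket n ({1..n} - X))"
    using block_reversal_beta_ord[OF rev lex_less_compl[OF sub]] by (simp only: compl_packet[OF sub])
  moreover have "{1..n} - X \<in> nsets_pred n (n - k)" using X by (simp add: nsets_pred_eq[OF k])
  moreover have "beta n C \<in> coBruhat n (n - k)" "beta n D \<in> coBruhat n (n - k)"
    using bij_betwE[OF bij_betw_beta[OF k]] CD by auto
  ultimately show "(beta n C, beta n D) \<in> coBruhat_cover n (n - k)"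
    unfolding coBruhat_cover_def by blast
next
  assume "(beta n C, beta n D) \<in> coBruhat_cover n (n - k)"
  then obtain \<rho> \<sigma> Z where mem: "\<rho> \<in> beta n C" "\<sigma> \<in> beta n D" and Z: "Z \<in> nsets_pred n (n - k)"
    and rev: "(\<rho>, \<sigma>) \<in> block_reversal (copacket n Z)"
    and co: "beta n C \<in> coBruhat n (n - k)" "beta n D \<in> coBruhat n (n - k)"
    by (auto simp: coBruhat_cover_def)
  obtain X where X: "X \<in> [{1..n}]\<^bsup>Suc k\<^esup>" "Z = {1..n} - X"
    using Z nsets_pred_eq[OF k] by blast
  have sub: "X \<subseteq> {1..n}" using X by (simp add: nsets_def)
  have "beta_ord n (beta_ord n \<rho>) = \<rho>" "beta_ord n (beta_ord n \<sigma>) = \<sigma>"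
    using beta_ord_invol[OF coadmissible_subset[OF coBruhat_mem(1)]] mem co by blast+
  then have "beta_ord n \<rho> \<in> C" "beta_ord n \<sigma> \<in> D"
    using mem CD beta_ord_mem_beta_iff set_beta_ord_subset by metis+
  moreover have "(beta_ord n \<rho>, beta_ord n \<sigma>) \<in> block_reversal (packet X)"
  proof -
    have "lex_less ({1..n} - U) ({1..n} - V) \<longleftrightarrow> lex_less V U"
      if "U \<in> copacket n Z" "V \<in> copacket n Z" for U V
    proof -
      from that obtain U' V' where UV: "U = {1..n} - U'" "V = {1..n} - V'"
        "U' \<in> packet X" "V' \<in> packet X"
        unfolding X(2) compl_packet[OF sub, symmetric] by blast
      moreover have "{1..n} - ({1..n} - U') = U'" "{1..n} - ({1..n} - V') = V'"
        using UV(3,4) sub by (auto simp: packet_def)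
      ultimately show ?thesis using lex_less_compl[OF sub UV(4,3)] by simp
    qed
    from block_reversal_beta_ord[OF rev this] show ?thesis
      unfolding X(2) by (simp only: compl_copacket[OF sub])
  qed
  ultimately show "(C, D) \<in> Bruhat_cover n k"
    using CD X(1) unfolding Bruhat_cover_def by blast
qed

section \<open>Complementation of consistent sets\<close>

lemma gamma_invol: "I \<subseteq> Pow {1..n} \<Longrightarrow> gamma n (gamma n I) = I"
  by (force simp: gamma_def image_image double_diff)

lemma gamma_nsets_subset: "k \<le> n \<Longrightarrow> I \<subseteq> [{1..n}]\<^bsup>k\<^esup> \<Longrightarrow> gamma n I \<subseteq> [{1..n}]\<^bsup>(n - k)\<^esup>"
  unfolding gamma_def using compl_nsets by blast

lemma nsets_Pow: "[A]\<^bsup>k\<^esup> \<subseteq> Pow A"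
  by (auto simp: nsets_def)

lemma compl_mem_gamma_iff:
  assumes "I \<subseteq> Pow {1..n}" "X \<subseteq> {1..n}"
  shows "{1..n} - X \<in> gamma n I \<longleftrightarrow> X \<in> I"
  unfolding gamma_def
  by (rule inj_on_image_mem_iff[OF inj_on_compl _ assms(1)]) (use assms(2) in auto)

text \<open>The copacket of the complement of \<open>Y\<close> is indexed by \<open>Y\<close>
  itself, and inserting \<open>y\<close> there gives the complement of \<open>Y - {y}\<close>. Both
  conditions thus become the same instance of \<open>between_closed\<close>.\<close>

lemma coconsistent_gamma:
  assumes "k \<le> n" "I \<subseteq> [{1..n}]\<^bsup>k\<^esup>"
  shows "coconsistent n (n - k) (gamma n I) \<longleftrightarrow> consistent n k I"
proof -
  have I_Pow: "I \<subseteq> Pow {1..n}" using assms(2) nsets_Pow by blast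
  have "between_closed ({1..n} - ({1..n} - Y)) (\<lambda>z. insert z ({1..n} - Y) \<in> gamma n I) \<longleftrightarrow>
      between_closed Y (\<lambda>y. Y - {y} \<in> I)" if "Y \<in> [{1..n}]\<^bsup>Suc k\<^esup>" for Y
  proof -
    have Y: "Y \<subseteq> {1..n}" using that by (simp add: nsets_def)
    have "insert y ({1..n} - Y) \<in> gamma n I \<longleftrightarrow> Y - {y} \<in> I" if "y \<in> Y" for y
    proof -
      have "insert y ({1..n} - Y) = {1..n} - (Y - {y})" using Y that by blast
      then show ?thesis using compl_mem_gamma_iff[OF I_Pow, of "Y - {y}"] Y by auto
    qed
    then show ?thesis using Y by (simp add: between_closed_def double_diff)
  qed
  then show ?thesis
    using assms gamma_nsets_subset
    by (simp add: coconsistent_iff consistent_iff nsets_pred_eq)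
qed

lemma bij_betw_gamma:
  assumes "k \<le> n"
  shows "bij_betw (gamma n) (Cons_sets n k) (coCons_sets n (n - k))"
proof (rule bij_betwI[where g = "gamma n"])
  have sub: "I \<subseteq> [{1..n}]\<^bsup>k\<^esup>" if "consistent n k I" for I
    using that by (simp add: consistent_def)
  have cosub: "I \<subseteq> [{1..n}]\<^bsup>(n - k)\<^esup>" if "coconsistent n (n - k) I" for I
    using that by (simp add: coconsistent_def)
  show "gamma n (gamma n I) = I" if "I \<in> Cons_sets n k" for I
    using that unfolding Cons_sets_def
    by (intro gamma_invol[OF subset_trans[OF sub nsets_Pow]]) blast
  show invol: "gamma n (gamma n I) = I" if "I \<in> coCons_sets n (n - k)" for I
    using that unfolding coCons_sets_def
    by (intro gamma_invol[OF subset_trans[OF cosub nsets_Pow]]) blast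
  show "gamma n \<in> Cons_sets n k \<rightarrow> coCons_sets n (n - k)"
    using coconsistent_gamma[OF assms] sub by (auto simp: Cons_sets_def coCons_sets_def)
  show "gamma n \<in> coCons_sets n (n - k) \<rightarrow> Cons_sets n k"
  proof
    fix I assume I: "I \<in> coCons_sets n (n - k)"
    then have "gamma n I \<subseteq> [{1..n}]\<^bsup>k\<^esup>"
      using gamma_nsets_subset[of "n - k" n I] cosub assms by (simp add: coCons_sets_def)
    then show "gamma n I \<in> Cons_sets n k"
      using coconsistent_gamma[OF assms, of "gamma n I"] invol[OF I] I
      by (simp add: Cons_sets_def coCons_sets_def)
  qed
qed

lemma gamma_single_step_iff:
  assumes k: "k \<le> n" and IJ: "I \<in> Cons_sets n k" "J \<in> Cons_sets n k"
  shows "(I, J) \<in> single_step (Cons_sets n k) \<longleftrightarrow>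
    (gamma n I, gamma n J) \<in> single_step (coCons_sets n (n - k))"
proof -
  have Pow: "I \<subseteq> Pow {1..n}" "J \<subseteq> Pow {1..n}"
    using IJ nsets_Pow by (fastforce simp: Cons_sets_def consistent_def)+
  have "(\<exists>y. y \<notin> I \<and> J = I \<union> {y}) \<longleftrightarrow> (\<exists>z. z \<notin> gamma n I \<and> gamma n J = gamma n I \<union> {z})"
  proof
    assume "\<exists>y. y \<notin> I \<and> J = I \<union> {y}"
    then obtain y where "y \<notin> I" "J = I \<union> {y}" by blast
    moreover from this have "y \<subseteq> {1..n}" using Pow(2) by blast
    ultimately have "{1..n} - y \<notin> gamma n I" "gamma n J = gamma n I \<union> {{1..n} - y}"
      using compl_mem_gamma_iff[OF Pow(1)] by (simp, simp add: gamma_def)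
    then show "\<exists>z. z \<notin> gamma n I \<and> gamma n J = gamma n I \<union> {z}" by blast
  next
    assume "\<exists>z. z \<notin> gamma n I \<and> gamma n J = gamma n I \<union> {z}"
    then obtain z where z: "z \<notin> gamma n I" "gamma n J = gamma n I \<union> {z}" by blast
    then have "z \<in> gamma n J" by simp
    then obtain y where y: "y \<in> J" "z = {1..n} - y" unfolding gamma_def by blast
    have "gamma n J = gamma n (I \<union> {y})" using z(2) y(2) by (simp add: gamma_def)
    moreover have "I \<union> {y} \<subseteq> Pow {1..n}" using Pow y(1) by blast
    ultimately have "J = I \<union> {y}" using gamma_invol Pow(2) by metis
    moreover have "y \<notin> I" using z(1) y(2) by (auto simp: gamma_def)
    ultimately show "\<exists>y. y \<notin> I \<and> J = I \<union> {y}" by blast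
  qed
  moreover have "gamma n I \<in> coCons_sets n (n - k)" "gamma n J \<in> coCons_sets n (n - k)"
    using bij_betwE[OF bij_betw_gamma[OF k]] IJ by auto
  ultimately show ?thesis using IJ by (simp add: single_step_def)
qed

lemma poset_iso_gamma:
  assumes "k \<le> n"
  shows "poset_iso (Cons_sets n k) (Cons_le n k) (coCons_sets n (n - k)) (coCons_le n (n - k))
    (gamma n)"
  unfolding Cons_le_def coCons_le_def
  using bij_betw_gamma[OF assms] single_step_subset single_step_subset
    gamma_single_step_iff[OF assms] disjI2[OF antisym_closure_on_single_step]
  by (rule poset_iso_closure_on)

lemma poset_iso_beta:
  assumes "1 \<le> k" "k \<le> n"
  shows "poset_iso (Bruhat n k) (Bruhat_le n k) (coBruhat n (n - k)) (coBruhat_le n (n - k)) (beta n)"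
proof -
  \<comment> \<open>This comes from inclusion of consistent sets by way of \<open>Rev\<close>;
    \<open>beta\<close> then passes it on to the dual order.\<close>
  have "antisym (Bruhat_le n k)"
    using poset_iso_Rev[OF assms(1)] by (simp add: poset_iso_def partial_order_on_def)
  then show ?thesis
    unfolding Bruhat_le_def coBruhat_le_def
    by (intro poset_iso_closure_on bij_betw_beta Bruhat_cover_subset coBruhat_cover_subset
        beta_cover_iff disjI1 assms(2))
qed

lemma Corev_beta:
  assumes "k \<le> n" "C \<in> Bruhat n k"
  shows "gamma n (Rev n k C) = Corev n (n - k) (beta n C)"
proof -
  obtain \<rho> where \<rho>: "C = comm_class \<rho>" "admissible n k \<rho>"
    using assms(2) by (auto simp: Bruhat_eq)
  then have orders: "\<rho> \<in> total_orders n k" by (simp add: admissible_def)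
  then have "coadmissible n (n - k) (beta_ord n \<rho>)"
    using coadmissible_beta_ord[OF assms(1)] \<rho>(2) by simp
  then show ?thesis
    using \<rho> Corev_ord_beta_ord[OF assms(1) orders]
    by (simp add: Rev_comm_class beta_comm_class Corev_comm_class)
qed

theorem theorem1:
  fixes n k :: nat
  assumes "1 \<le> k" and "k < n"
  shows
    \<comment> \<open>the maps on commutation classes are well defined\<close>
    "(\<forall>\<rho>. admissible n k \<rho> \<longrightarrow> Rev n k (comm_class \<rho>) = Rev_ord n k \<rho>) \<and>
     (\<forall>\<rho>. coadmissible n (n - k) \<rho> \<longrightarrow>
        Corev n (n - k) (comm_class \<rho>) = Corev_ord n (n - k) \<rho>) \<and>
     (\<forall>\<rho>. admissible n k \<rho> \<longrightarrow> beta n (comm_class \<rho>) = comm_class (beta_ord n \<rho>)) \<and>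
     poset_iso (Bruhat n k) (Bruhat_le n k) (Cons_sets n (k + 1)) (Cons_le n (k + 1)) (Rev n k) \<and>
     poset_iso (coBruhat n (n - k)) (coBruhat_le n (n - k))
       (coCons_sets n (n - k - 1)) (coCons_le n (n - k - 1)) (Corev n (n - k)) \<and>
     poset_iso (Bruhat n k) (Bruhat_le n k)
       (coBruhat n (n - k)) (coBruhat_le n (n - k)) (beta n) \<and>
     poset_iso (Cons_sets n (k + 1)) (Cons_le n (k + 1))
       (coCons_sets n (n - k - 1)) (coCons_le n (n - k - 1)) (gamma n) \<and>
     (\<forall>C \<in> Bruhat n k. gamma n (Rev n k C) = Corev n (n - k) (beta n C))"
proof -
  have kn: "k \<le> n" "k + 1 \<le> n" using assms by simp_all
  have Rev: "poset_iso (Bruhat n k) (Bruhat_le n k) (Cons_sets n (k + 1)) (Cons_le n (k + 1)) (Rev n k)"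
    using poset_iso_Rev[OF assms(1)] .
  have gamma: "poset_iso (Cons_sets n (k + 1)) (Cons_le n (k + 1))
       (coCons_sets n (n - k - 1)) (coCons_le n (n - k - 1)) (gamma n)"
    using poset_iso_gamma[OF kn(2)] by (simp only: diff_diff_left)
  have beta: "poset_iso (Bruhat n k) (Bruhat_le n k)
       (coBruhat n (n - k)) (coBruhat_le n (n - k)) (beta n)"
    using poset_iso_beta[OF assms(1) kn(1)] .
  have comm: "\<forall>C \<in> Bruhat n k. gamma n (Rev n k C) = Corev n (n - k) (beta n C)"
    using Corev_beta[OF kn(1)] by blast
  \<comment> \<open>By commutativity, \<open>Corev\<close> after \<open>beta\<close> agrees with
    \<open>gamma\<close> after \<open>Rev\<close>, a composition of isomorphisms, and
    \<open>beta\<close> can be cancelled.\<close>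
  have "poset_iso (coBruhat n (n - k)) (coBruhat_le n (n - k))
       (coCons_sets n (n - k - 1)) (coCons_le n (n - k - 1)) (Corev n (n - k))"
    using comm by (intro poset_iso_cancel[OF beta poset_iso_comp[OF Rev gamma]]) simp
  with Rev gamma beta comm show ?thesis
    by (simp add: Rev_comm_class Corev_comm_class beta_comm_class)
qed

end
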